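(* Let $1\le p<\infty$. For any Banach spaces $E$ and $F$, the sequence $(\mathcal P_{K_p}(^mE;F),\kappa_p)_m$, $m=0,1,2,\dots$, is a holomorphy type from $E$ to $F$.
   Context: Banach spaces are complex; $B_E$ is the closed unit ball of $E$. $\mathcal P(^mE;F)$ is the space of continuous $m$-homogeneous polynomials from $E$ to $F$, with $\mathcal P(^0E;F)=F$ (constants). $\ell_p(F)$ is the Banach space of $p$-summable sequences in $F$ with its natural norm $\|\cdot\|_p$. For $(y_n)_n\in\ell_p(F)$ put $p\text{-co}\{y_n\}=\{\sum_n\alpha_ny_n:(\alpha_n)_n\in B_{\ell_q}\}$, $\frac1p+\frac1q=1$. A set $K\subset F$ is relatively $p$-compact if it is contained in the closure of $p\text{-co}\{y_n\}$ for some $(y_n)_n\in\ell_p(F)$, and $m_p(K)=\inf\{\|(y_n)_n\|_p:K\subset p\text{-co}\{y_n\}\}$. $P\in\mathcal P(^mE;F)$ is $p$-compact if $P(B_E)$ is relatively $p$-compact; $\mathcal P_{K_p}(^mE;F)$ is the space of such polynomials, with norm $\kappa_p(P)=m_p(P(B_E))$; $\mathcal P_{K_p}(^0E;F)=F$. For $P\in\mathcal P(^mE;F)$ and $a\in E$, $P_l(P)(a)\in\mathcal P(^lE;F)$ denotes the $l$-homogeneous component of the Taylor expansion of $P$ at $a$, so $P(x)=\sum_{l=0}^mP_l(P)(a)(x-a)$. A holomorphy type from $E$ to $F$ is a sequence of Banach spaces $(\mathcal P_\theta(^mE;F),\|\cdot\|_\theta)_{m\ge0}$ such that: (1) each $\mathcal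 P_\theta(^mE;F)$ is a vector subspace of $\mathcal P(^mE;F)$; (2) $\mathcal P_\theta(^0E;F)=F$ as normed spaces; (3) there is $\sigma\ge1$ such that for all $l\le m$, all $P\in\mathcal P_\theta(^mE;F)$ and all $a\in E$, one has $P_l(P)(a)\in\mathcal P_\theta(^lE;F)$ and $\|P_l(P)(a)\|_\theta\le\sigma^m\|P\|_\theta\|a\|^{m-l}$. *)

theory Defs
  imports "HOL-Analysis.Analysis"
begin

section \<open>Complex Banach spaces\<close>

text \<open>The real structure inherited from \<^class>\<open>banach\<close> is the restriction of the complex one.\<close>

class complex_banach = banach +
  fixes scaleC :: "complex \<Rightarrow> 'a \<Rightarrow> 'a" (infixr "*\<^sub>C" 75)
  assumes scaleC_add_right: "c *\<^sub>C (x + y) = c *\<^sub>C x + c *\<^sub>C y"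
    and scaleC_add_left: "(c + d) *\<^sub>C x = c *\<^sub>C x + d *\<^sub>C x"
    and scaleC_scaleC: "c *\<^sub>C (d *\<^sub>C x) = (c * d) *\<^sub>C x"
    and scaleC_one: "1 *\<^sub>C x = x"
    and scaleR_scaleC: "r *\<^sub>R x = complex_of_real r *\<^sub>C x"
    and norm_scaleC: "norm (c *\<^sub>C x) = cmod c * norm x"

lemma vector_space_scaleC: "vector_space (scaleC :: complex \<Rightarrow> 'a::complex_banach \<Rightarrow> 'a)"
  by unfold_locales (simp_all add: scaleC_add_right scaleC_add_left scaleC_scaleC scaleC_one)


section \<open>Continuous homogeneous polynomials\<close>

text \<open>An \<open>m\<close>-linear map on \<open>E\<^sup>m\<close> is encoded as a function of sequences in \<open>E\<close> that depends
  only on the entries with index below \<open>m\<close>.\<close>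

definition multilinear_map :: "nat \<Rightarrow> ((nat \<Rightarrow> 'a::complex_banach) \<Rightarrow> 'b::complex_banach) \<Rightarrow> bool"
  where "multilinear_map m A \<longleftrightarrow>
    (\<forall>x y. (\<forall>i<m. x i = y i) \<longrightarrow> A x = A y) \<and>
    (\<forall>i<m. \<forall>x. Vector_Spaces.linear (*\<^sub>C) (*\<^sub>C) (\<lambda>z. A (x(i := z))))"

text \<open>For \<open>m = 0\<close> these are exactly the constant functions.\<close>

definition hpoly :: "nat \<Rightarrow> ('a::complex_banach \<Rightarrow> 'b::complex_banach) set"
  where "hpoly m = {P. continuous_on UNIV P \<and>
    (\<exists>A. multilinear_map m A \<and> (\<forall>x. P x = A (\<lambda>_. x)))}"

text \<open>\<open>taylor_component m P a l\<close> is \<open>P\<^sub>l(P)(a)\<close>, for \<open>P\<close> in \<open>hpoly m\<close> and \<open>l \<le> m\<close>.\<close>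

definition taylor_component ::
    "nat \<Rightarrow> ('a::complex_banach \<Rightarrow> 'b::complex_banach) \<Rightarrow> 'a \<Rightarrow> nat \<Rightarrow> 'a \<Rightarrow> 'b"
  where "taylor_component m P a l = (THE R. \<exists>Q. (\<forall>k\<le>m. Q k \<in> hpoly k) \<and>
    (\<forall>x. P x = (\<Sum>k\<le>m. Q k (x - a))) \<and> R = Q l)"


section \<open>Holomorphy types\<close>

definition complex_subspace :: "('a \<Rightarrow> 'b::complex_banach) set \<Rightarrow> bool"
  where "complex_subspace S \<longleftrightarrow> (\<lambda>_. 0) \<in> S \<and>
    (\<forall>f\<in>S. \<forall>g\<in>S. (\<lambda>x. f x + g x) \<in> S) \<and>
    (\<forall>c. \<forall>f\<in>S. (\<lambda>x. c *\<^sub>C f x) \<in> S)"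

definition norm_on :: "('a \<Rightarrow> 'b::complex_banach) set \<Rightarrow> (('a \<Rightarrow> 'b) \<Rightarrow> real) \<Rightarrow> bool"
  where "norm_on S N \<longleftrightarrow>
    (\<forall>f\<in>S. 0 \<le> N f) \<and>
    (\<forall>f\<in>S. N f = 0 \<longleftrightarrow> f = (\<lambda>_. 0)) \<and>
    (\<forall>f\<in>S. \<forall>g\<in>S. N (\<lambda>x. f x + g x) \<le> N f + N g) \<and>
    (\<forall>c. \<forall>f\<in>S. N (\<lambda>x. c *\<^sub>C f x) = cmod c * N f)"

definition complete_for :: "('a \<Rightarrow> 'b::complex_banach) set \<Rightarrow> (('a \<Rightarrow> 'b) \<Rightarrow> real) \<Rightarrow> bool"
  where "complete_for S N \<longleftrightarrow>
    (\<forall>X :: nat \<Rightarrow> 'a \<Rightarrow> 'b. (\<forall>n. X n \<in> S) \<longrightarrow>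
      (\<forall>e>0. \<exists>M. \<forall>i\<ge>M. \<forall>j\<ge>M. N (\<lambda>x. X i x - X j x) < e) \<longrightarrow>
      (\<exists>L\<in>S. (\<lambda>n. N (\<lambda>x. X n x - L x)) \<longlonglongrightarrow> 0))"

definition banach_function_space ::
    "('a \<Rightarrow> 'b::complex_banach) set \<Rightarrow> (('a \<Rightarrow> 'b) \<Rightarrow> real) \<Rightarrow> bool"
  where "banach_function_space S N \<longleftrightarrow> complex_subspace S \<and> norm_on S N \<and> complete_for S N"

definition holomorphy_type ::
    "(nat \<Rightarrow> ('a::complex_banach \<Rightarrow> 'b::complex_banach) set) \<Rightarrow>
     (nat \<Rightarrow> ('a \<Rightarrow> 'b) \<Rightarrow> real) \<Rightarrow> bool"
  where "holomorphy_type S N \<longleftrightarrow>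
    (\<forall>m. S m \<subseteq> hpoly m \<and> banach_function_space (S m) (N m)) \<and>
    (S 0 = range (\<lambda>c _. c) \<and> (\<forall>c. N 0 (\<lambda>_. c) = norm c)) \<and>
    (\<exists>\<sigma>\<ge>1. \<forall>m. \<forall>l\<le>m. \<forall>P\<in>S m. \<forall>a.
       taylor_component m P a l \<in> S l \<and>
       N l (taylor_component m P a l) \<le> \<sigma> ^ m * N m P * norm a ^ (m - l))"


section \<open>\<open>p\<close>-compact sets and polynomials\<close>

definition lp :: "ereal \<Rightarrow> (nat \<Rightarrow> 'a::real_normed_vector) set"
  where "lp p = (if p = \<infinity> then {y. bounded (range y)}
    else {y. summable (\<lambda>n. norm (y n) powr real_of_ereal p)})"

definition lp_norm :: "ereal \<Rightarrow> (nat \<Rightarrow> 'a::real_normed_vector) \<Rightarrow> real"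
  where "lp_norm p y = (if p = \<infinity> then (SUP n. norm (y n))
    else (\<Sum>n. norm (y n) powr real_of_ereal p) powr (1 / real_of_ereal p))"

definition conj_exponent :: "real \<Rightarrow> ereal"
  where "conj_exponent p = (if p = 1 then \<infinity> else ereal (p / (p - 1)))"

lemma conj_exponent:
  assumes "1 \<le> p"
  shows "1 / ereal p + 1 / conj_exponent p = 1"
  using assms by (auto simp: conj_exponent_def one_ereal_def field_simps)

text \<open>By Hoelder's inequality, the series below converge for all \<open>y\<close> in \<open>lp p\<close>.\<close>

definition p_co :: "real \<Rightarrow> (nat \<Rightarrow> 'b::complex_banach) \<Rightarrow> 'b set"
  where "p_co p y = {x. \<exists>\<alpha> :: nat \<Rightarrow> complex. \<alpha> \<in> lp (conj_exponent p) \<and>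
    lp_norm (conj_exponent p) \<alpha> \<le> 1 \<and> (\<lambda>n. \<alpha> n *\<^sub>C y n) sums x}"

definition relatively_p_compact :: "real \<Rightarrow> 'b::complex_banach set \<Rightarrow> bool"
  where "relatively_p_compact p K \<longleftrightarrow> (\<exists>y \<in> lp (ereal p). K \<subseteq> closure (p_co p y))"

definition m_p :: "real \<Rightarrow> 'b::complex_banach set \<Rightarrow> real"
  where "m_p p K = Inf {lp_norm (ereal p) y | y. y \<in> lp (ereal p) \<and> K \<subseteq> p_co p y}"

text \<open>The case \<open>m = 0\<close> is not treated separately: a constant has a one-point image, so it is
  \<open>p\<close>-compact with \<open>\<kappa>\<^sub>p\<close> equal to its norm.\<close>

definition p_compact_hpoly :: "real \<Rightarrow> nat \<Rightarrow> ('a::complex_banach \<Rightarrow> 'b::complex_banach) set"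
  where "p_compact_hpoly p m = {P \<in> hpoly m. relatively_p_compact p (P ` cball 0 1)}"

definition kappa_p :: "real \<Rightarrow> ('a::complex_banach \<Rightarrow> 'b::complex_banach) \<Rightarrow> real"
  where "kappa_p p P = m_p p (P ` cball 0 1)"

end

theory Submission
  imports Defs
begin

text \<open>Hoelder's inequality and compactness of the unit ball of \<open>\<ell>\<^sub>q\<close> in the product topology make the set
  \<open>p_co p y\<close> compact, so the closure in the definition of relative \<open>p\<close>-compactness is harmless.
  The gauge \<open>m_p\<close> is countably subadditive: dominating sequences for the summands can be merged into
  one, after weighting, without losing a constant. This gives the norm axioms and, applied to a
  telescoping series, completeness.

  The Taylor component \<open>P\<^sub>l(P)(a)\<close> is recovered from \<open>P\<close> by averaging over roots of unity \<open>\<omega>\<close> of order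
  \<open>m + 1\<close>: \<open>P\<^sub>l(P)(a)(z)\<close> is the mean of \<open>\<omega>\<^bsup>-jl\<^esup> P(a + \<omega>\<^sup>j z)\<close> over \<open>j \<le> m\<close>. The same formula yields uniqueness and
  continuity of Taylor components, and for \<open>\<parallel>a\<parallel> \<le> 1\<close> it bounds \<open>\<kappa>\<^sub>p(P\<^sub>l(P)(a))\<close> by \<open>2\<^sup>m \<kappa>\<^sub>p(P)\<close>; homogeneity of
  degree \<open>m - l\<close> in \<open>a\<close> then gives the general estimate with \<open>\<sigma> = 2\<close>.\<close>

section \<open>Hoelder's inequality and compactness of \<open>p\<close>-convex hulls\<close>

lemma bounded_linear_scaleC_right: "bounded_linear (\<lambda>x::'a::complex_banach. c *\<^sub>C x)"
proof (rule bounded_linear_intro[where K = "cmod c"])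
  show "c *\<^sub>C (r *\<^sub>R x) = r *\<^sub>R (c *\<^sub>C x)" for r and x :: 'a
    by (simp add: scaleR_scaleC scaleC_scaleC mult.commute)
qed (simp_all add: scaleC_add_right norm_scaleC)

lemma bounded_linear_scaleC_left: "bounded_linear (\<lambda>c. c *\<^sub>C (x::'a::complex_banach))"
proof (rule bounded_linear_intro[where K = "norm x"])
  show "(r *\<^sub>R c) *\<^sub>C x = r *\<^sub>R (c *\<^sub>C x)" for r and c
    by (simp add: scaleR_scaleC scaleC_scaleC scaleR_conv_of_real)
qed (simp_all add: scaleC_add_left norm_scaleC)

interpretation scaleC: vector_space "scaleC :: complex \<Rightarrow> 'a::complex_banach \<Rightarrow> 'a"
  by (rule vector_space_scaleC)

lemma tendsto_scaleC [tendsto_intros]: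
  "(f \<longlongrightarrow> l) F \<Longrightarrow> ((\<lambda>x. c *\<^sub>C f x) \<longlongrightarrow> c *\<^sub>C l) F"
  by (rule bounded_linear.tendsto[OF bounded_linear_scaleC_right])

lemma continuous_on_scaleC [continuous_intros]:
  "continuous_on S f \<Longrightarrow> continuous_on S (\<lambda>x. c *\<^sub>C f x)"
  by (rule bounded_linear.continuous_on[OF bounded_linear_scaleC_right])

section \<open>Sequence spaces and the unit ball of coefficients\<close>

text \<open>Partial sums of nonnegative terms converge as soon as they are bounded. Membership and
  norm bound thus become one condition on finite sums, which is easy to estimate and closed under
  coordinatewise limits.\<close>

lemma lp_norm_le_iff:
  fixes y :: "nat \<Rightarrow> 'a::real_normed_vector"
  assumes "0 < p" "0 \<le> B"
  shows "y \<in> lp (ereal p) \<and> lp_norm (ereal p) y \<le> B \<longleftrightarrow> (\<forall>N. (\<Sum>n<N. norm (y n) powr p) \<le> B powr p)"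
proof -
  let ?f = "\<lambda>n. norm (y n) powr p"
  have *: "suminf ?f powr (1 / p) \<le> B \<longleftrightarrow> suminf ?f \<le> B powr p" if "summable ?f"
  proof
    have "0 \<le> suminf ?f"
      using that by (simp add: suminf_nonneg)
    then show "suminf ?f powr (1 / p) \<le> B \<Longrightarrow> suminf ?f \<le> B powr p"
      using powr_mono2[of p "suminf ?f powr (1 / p)" B] assms by (simp add: powr_powr)
    show "suminf ?f \<le> B powr p \<Longrightarrow> suminf ?f powr (1 / p) \<le> B"
      using powr_mono2[of "1 / p" "suminf ?f" "B powr p"] assms \<open>0 \<le> suminf ?f\<close>
      by (simp add: powr_powr)
  qed
  show ?thesis
  proof
    assume "y \<in> lp (ereal p) \<and> lp_norm (ereal p) y \<le> B"
    then have "summable ?f" "suminf ?f \<le> B powr p"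
      using * by (auto simp: lp_def lp_norm_def)
    then show "\<forall>N. sum ?f {..<N} \<le> B powr p"
      by (meson finite_lessThan order_trans powr_ge_zero sum_le_suminf)
  next
    assume le: "\<forall>N. sum ?f {..<N} \<le> B powr p"
    then have "summable ?f"
      by (intro summableI_nonneg_bounded) auto
    then show "y \<in> lp (ereal p) \<and> lp_norm (ereal p) y \<le> B"
      using * le by (auto simp: lp_def lp_norm_def intro: suminf_le_const)
  qed
qed

lemma lp_norm_nonneg:
  fixes y :: "nat \<Rightarrow> 'a::real_normed_vector"
  shows "0 \<le> lp_norm (ereal p) y"
  by (simp add: lp_norm_def)

text \<open>The admissible coefficients in \<open>p_co\<close>. As a subset of
  \<open>nat \<Rightarrow> complex\<close> the ball carries the topology of coordinatewise
  convergence.\<close>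

definition lq_ball :: "real \<Rightarrow> (nat \<Rightarrow> complex) set"
  where "lq_ball p = {\<alpha>. \<alpha> \<in> lp (conj_exponent p) \<and> lp_norm (conj_exponent p) \<alpha> \<le> 1}"

lemma p_co_eq: "p_co p y = {x. \<exists>\<alpha>\<in>lq_ball p. (\<lambda>n. \<alpha> n *\<^sub>C y n) sums x}"
  by (auto simp: p_co_def lq_ball_def)

lemma lq_ball_one: "lq_ball 1 = {\<alpha>. \<forall>n. cmod (\<alpha> n) \<le> 1}"
proof -
  have "bounded (range \<alpha>) \<and> (SUP n. cmod (\<alpha> n)) \<le> 1 \<longleftrightarrow> (\<forall>n. cmod (\<alpha> n) \<le> 1)" for \<alpha> :: "nat \<Rightarrow> complex"
  proof
    assume "bounded (range \<alpha>) \<and> (SUP n. cmod (\<alpha> n)) \<le> 1"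
    then show "\<forall>n. cmod (\<alpha> n) \<le> 1"
      by (metis UNIV_I bdd_above_norm cSUP_upper image_image order_trans)
  next
    assume "\<forall>n. cmod (\<alpha> n) \<le> 1"
    then show "bounded (range \<alpha>) \<and> (SUP n. cmod (\<alpha> n)) \<le> 1"
      by (auto simp: bounded_iff intro!: cSUP_least)
  qed
  then show ?thesis
    by (simp add: lq_ball_def lp_def lp_norm_def conj_exponent_def)
qed

lemma lq_ball_gt_one:
  assumes "1 < p"
  shows "lq_ball p = {\<alpha>. \<forall>N. (\<Sum>n<N. cmod (\<alpha> n) powr (p / (p - 1))) \<le> 1}"
  using assms lp_norm_le_iff[of "p / (p - 1)" 1]
  by (auto simp: lq_ball_def conj_exponent_def)

lemma cmod_le_one_lq_ball:
  assumes "1 \<le> p" "\<alpha> \<in> lq_ball p"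
  shows "cmod (\<alpha> n) \<le> 1"
proof (cases "p = 1")
  case False
  define q where "q = p / (p - 1)"
  have "0 < q" "1 < p"
    using False assms by (auto simp: q_def)
  have "cmod (\<alpha> n) powr q \<le> (\<Sum>k<Suc n. cmod (\<alpha> k) powr q)"
    by (rule member_le_sum) auto
  also have "\<dots> \<le> 1"
    using assms(2) \<open>1 < p\<close> by (simp only: lq_ball_gt_one q_def) blast
  finally have "(cmod (\<alpha> n) powr q) powr (1 / q) \<le> 1 powr (1 / q)"
    using \<open>0 < q\<close> by (intro powr_mono2) auto
  then show ?thesis
    using \<open>0 < q\<close> by (simp add: powr_powr)
qed (use assms in \<open>auto simp: lq_ball_one\<close>)

lemma Holder_lq_ball_sum:
  fixes y :: "nat \<Rightarrow> 'a::real_normed_vector"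
  assumes p: "1 \<le> p" and \<alpha>: "\<alpha> \<in> lq_ball p" and y: "y \<in> lp (ereal p)"
  shows "(\<Sum>n<N. cmod (\<alpha> n) * norm (y n)) \<le> lp_norm (ereal p) y"
proof (rule dense_ge)
  \<comment> \<open>The norm may be 0, so it is approached from above by numbers
    \<open>B > 0\<close>, by which the terms can be divided.\<close>
  fix B
  assume B: "lp_norm (ereal p) y < B"
  then have "0 < B"
    using lp_norm_nonneg[of p y] by simp
  then have le: "(\<Sum>n<N. norm (y n) powr p) \<le> B powr p"
    using lp_norm_le_iff[of p B y] p y B by simp
  show "(\<Sum>n<N. cmod (\<alpha> n) * norm (y n)) \<le> B"
  proof (cases "p = 1")
    case True
    have "(\<Sum>n<N. cmod (\<alpha> n) * norm (y n)) \<le> (\<Sum>n<N. norm (y n))"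
      using cmod_le_one_lq_ball[OF p \<alpha>] by (intro sum_mono mult_left_le_one_le) auto
    then show ?thesis
      using le True \<open>0 < B\<close> by simp
  next
    case False
    define q where "q = p / (p - 1)"
    have "1 < p" "1 < q" and pq: "1 / q + 1 / p = 1"
      using False p by (auto simp: q_def divide_simps)
    have "(\<Sum>n<N. cmod (\<alpha> n) * norm (y n)) / B = (\<Sum>n<N. cmod (\<alpha> n) * (norm (y n) / B))"
      by (simp add: sum_divide_distrib)
    \<comment> \<open>Young's inequality is applied termwise after normalising by \<open>B\<close>;
      each of the two resulting power sums is at most 1.\<close>
    also have "\<dots> \<le> (\<Sum>n<N. cmod (\<alpha> n) powr q / q + (norm (y n) / B) powr p / p)"
      using \<open>1 < p\<close> \<open>1 < q\<close> pq \<open>0 < B\<close> by (intro sum_mono Youngs_inequality) auto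
    also have "\<dots> = (\<Sum>n<N. cmod (\<alpha> n) powr q) / q + (\<Sum>n<N. norm (y n) powr p) / B powr p / p"
      using \<open>0 < B\<close> by (simp add: sum.distrib powr_divide sum_divide_distrib)
    also have "\<dots> \<le> 1 / q + 1 / p"
      using \<alpha> le \<open>1 < p\<close> \<open>1 < q\<close> \<open>0 < B\<close>
      by (intro add_mono divide_right_mono) (auto simp: lq_ball_gt_one q_def)
    finally show ?thesis
      using \<open>0 < B\<close> pq by (simp add: divide_simps)
  qed
qed

lemma Holder_lq_ball:
  fixes y :: "nat \<Rightarrow> 'a::complex_banach"
  assumes "1 \<le> p" "\<alpha> \<in> lq_ball p" "y \<in> lp (ereal p)"
  shows "summable (\<lambda>n. norm (\<alpha> n *\<^sub>C y n))"
    and "(\<Sum>n. norm (\<alpha> n *\<^sub>C y n)) \<le> lp_norm (ereal p) y"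
    and "summable (\<lambda>n. \<alpha> n *\<^sub>C y n)"
    and "norm (\<Sum>n. \<alpha> n *\<^sub>C y n) \<le> lp_norm (ereal p) y"
proof -
  note le = Holder_lq_ball_sum[OF assms, folded norm_scaleC]
  show sm: "summable (\<lambda>n. norm (\<alpha> n *\<^sub>C y n))"
    by (rule summableI_nonneg_bounded[OF _ le]) simp
  show le': "(\<Sum>n. norm (\<alpha> n *\<^sub>C y n)) \<le> lp_norm (ereal p) y"
    by (rule suminf_le_const[OF sm le])
  show "summable (\<lambda>n. \<alpha> n *\<^sub>C y n)"
    by (rule summable_norm_cancel[OF sm])
  show "norm (\<Sum>n. \<alpha> n *\<^sub>C y n) \<le> lp_norm (ereal p) y"
    by (rule order_trans[OF summable_norm[OF sm] le'])
qed

lemma p_co_eq_image: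
  fixes y :: "nat \<Rightarrow> 'a::complex_banach"
  assumes "1 \<le> p" "y \<in> lp (ereal p)"
  shows "p_co p y = (\<lambda>\<alpha>. \<Sum>n. \<alpha> n *\<^sub>C y n) ` lq_ball p"
  using Holder_lq_ball(3)[OF assms(1) _ assms(2)]
  by (auto simp: p_co_eq sums_iff)

lemma norm_le_lp_norm_p_co:
  assumes "1 \<le> p" "y \<in> lp (ereal p)" "x \<in> p_co p y"
  shows "norm x \<le> lp_norm (ereal p) y"
  using assms Holder_lq_ball(4)[OF assms(1) _ assms(2)] by (auto simp: p_co_eq_image)

section \<open>Compactness\<close>

text \<open>By Tychonoff's theorem the product of closed unit discs is compact. The ball is closed
  in it, being the whole product for \<open>p = 1\<close> and otherwise cut out by conditions that
  each involve finitely many coordinates.\<close>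

lemma compact_lq_ball:
  assumes "1 \<le> p"
  shows "compact (lq_ball p)"
proof -
  have "compactin (product_topology (\<lambda>i::nat. euclidean :: complex topology) UNIV) (PiE UNIV (\<lambda>_. cball 0 1))"
    by (simp add: compactin_PiE)
  then have cpt: "compact (PiE UNIV (\<lambda>_::nat. cball (0::complex) 1))"
    by (simp add: euclidean_product_topology)
  have "lq_ball p \<subseteq> PiE UNIV (\<lambda>_. cball 0 1)"
    using cmod_le_one_lq_ball[OF assms] by auto
  moreover have "closed (lq_ball p)"
  proof (cases "p = 1")
    case True
    have "lq_ball p = PiE UNIV (\<lambda>_. cball 0 1)"
      using True by (auto simp: lq_ball_one)
    then show ?thesis
      using compact_imp_closed[OF cpt] by simp
  next
    case False
    then have "1 < p"
      using assms by simp
    have coord: "continuous_on UNIV (\<lambda>\<alpha>. cmod (\<alpha> n) powr (p / (p - 1)))" for n :: nat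
      using \<open>1 < p\<close> by (intro continuous_on_powr' continuous_intros) auto
    have "closed {\<alpha> :: nat \<Rightarrow> complex. (\<Sum>n<N. cmod (\<alpha> n) powr (p / (p - 1))) \<le> 1}" for N
      by (intro closed_Collect_le continuous_intros coord)
    then show ?thesis
      using \<open>1 < p\<close> by (simp add: lq_ball_gt_one closed_Collect_all)
  qed
  ultimately show ?thesis
    using compact_Int_closed[OF cpt] by (metis inf.absorb_iff2)
qed

text \<open>Together with Hoelder's inequality this bounds the remainders of all series with
  coefficients in \<open>lq_ball p\<close> at once.\<close>

lemma lp_tail_small:
  fixes y :: "nat \<Rightarrow> 'a::real_normed_vector"
  assumes "1 \<le> p" "y \<in> lp (ereal p)" "0 < e"
  shows "\<exists>N0. \<forall>N\<ge>N0. (\<lambda>n. if n < N then 0 else y n) \<in> lp (ereal p) \<and>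
    lp_norm (ereal p) (\<lambda>n. if n < N then 0 else y n) \<le> e"
proof -
  let ?f = "\<lambda>n. norm (y n) powr p"
  have "summable ?f"
    using assms by (simp add: lp_def)
  moreover have "0 < e powr p"
    using assms by simp
  ultimately obtain N0 where N0: "\<And>m n. m \<ge> N0 \<Longrightarrow> norm (sum ?f {m..<n}) < e powr p"
    unfolding summable_Cauchy by blast
  have "(\<Sum>n<M. norm (if n < N then 0 else y n) powr p) \<le> e powr p" if "N \<ge> N0" for N M
  proof -
    have "(\<Sum>n<M. norm (if n < N then 0 else y n) powr p) = sum ?f {N..<M}"
      by (rule sum.mono_neutral_cong_right) auto
    also have "\<dots> \<le> e powr p"
      using N0[OF that, of M] by simp
    finally show ?thesis .
  qed
  then show ?thesis
    using lp_norm_le_iff[of p e "\<lambda>n. if n < _ then 0 else y n"] assms by auto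
qed

text \<open>The set is the image of the compact \<open>lq_ball p\<close> under summation against
  \<open>y\<close>. That map is continuous as a uniform limit of its partial sums, each of which
  depends on finitely many coordinates.\<close>

lemma compact_p_co:
  fixes y :: "nat \<Rightarrow> 'a::complex_banach"
  assumes p: "1 \<le> p" and y: "y \<in> lp (ereal p)"
  shows "compact (p_co p y)"
proof -
  have "uniform_limit (lq_ball p) (\<lambda>N \<alpha>. \<Sum>n<N. \<alpha> n *\<^sub>C y n) (\<lambda>\<alpha>. \<Sum>n. \<alpha> n *\<^sub>C y n) sequentially"
  proof (rule uniform_limitI)
    fix e :: real
    assume "0 < e"
    obtain N0 where N0: "\<And>N. N \<ge> N0 \<Longrightarrow> (\<lambda>n. if n < N then 0 else y n) \<in> lp (ereal p) \<and>
      lp_norm (ereal p) (\<lambda>n. if n < N then 0 else y n) \<le> e / 2"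
      using lp_tail_small[OF p y, of "e / 2"] \<open>0 < e\<close> by auto
    have "dist (\<Sum>n<N. \<alpha> n *\<^sub>C y n) (\<Sum>n. \<alpha> n *\<^sub>C y n) < e" if "N \<ge> N0" "\<alpha> \<in> lq_ball p" for N \<alpha>
    proof -
      let ?t = "\<lambda>n. if n < N then 0 else y n"
      \<comment> \<open>The remainder of the series is the full series for the tail
        \<open>?t\<close>, so that Hoelder's inequality applies to it.\<close>
      have "(\<lambda>n. \<alpha> n *\<^sub>C y n - (if n < N then \<alpha> n *\<^sub>C y n else 0)) sums
          ((\<Sum>n. \<alpha> n *\<^sub>C y n) - (\<Sum>n<N. \<alpha> n *\<^sub>C y n))"
        using sums_If_finite_set[of "{..<N}" "\<lambda>n. \<alpha> n *\<^sub>C y n"] Holder_lq_ball(3)[OF p that(2) y]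
        by (intro sums_diff) (auto intro: summable_sums)
      moreover have "\<alpha> n *\<^sub>C y n - (if n < N then \<alpha> n *\<^sub>C y n else 0) = \<alpha> n *\<^sub>C ?t n" for n
        by simp
      ultimately have "(\<Sum>n. \<alpha> n *\<^sub>C y n) - (\<Sum>n<N. \<alpha> n *\<^sub>C y n) = (\<Sum>n. \<alpha> n *\<^sub>C ?t n)"
        by (simp add: sums_iff)
      moreover have "norm (\<Sum>n. \<alpha> n *\<^sub>C ?t n) \<le> e / 2"
        using Holder_lq_ball(4)[OF p that(2), of ?t] N0[OF that(1)] by linarith
      ultimately show ?thesis
        using \<open>0 < e\<close> by (simp add: dist_norm norm_minus_commute)
    qed
    then show "\<forall>\<^sub>F N in sequentially. \<forall>\<alpha>\<in>lq_ball p.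
        dist (\<Sum>n<N. \<alpha> n *\<^sub>C y n) (\<Sum>n. \<alpha> n *\<^sub>C y n) < e"
      by (auto simp: eventually_sequentially)
  qed
  moreover have "continuous_on (lq_ball p) (\<lambda>\<alpha>. \<Sum>n<N. \<alpha> n *\<^sub>C y n)" for N
    by (intro continuous_on_sum bounded_linear.continuous_on[OF bounded_linear_scaleC_left]
        continuous_on_subset[OF continuous_on_product_coordinates]) auto
  ultimately have "continuous_on (lq_ball p) (\<lambda>\<alpha>. \<Sum>n. \<alpha> n *\<^sub>C y n)"
    by (intro uniform_limit_theorem) auto
  then show ?thesis
    by (simp add: p_co_eq_image[OF p y] compact_continuous_image compact_lq_ball[OF p])
qed

section \<open>The gauge \<open>m\<^sub>p\<close>\<close>

lemma relatively_p_compact_iff: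
  fixes K :: "'a::complex_banach set"
  assumes "1 \<le> p"
  shows "relatively_p_compact p K \<longleftrightarrow> (\<exists>y\<in>lp (ereal p). K \<subseteq> p_co p y)"
  unfolding relatively_p_compact_def
  by (rule bex_cong) (simp_all add: closure_closed compact_imp_closed[OF compact_p_co[OF assms]])

lemma m_p_nonneg:
  assumes "1 \<le> p" "relatively_p_compact p K"
  shows "0 \<le> m_p p K"
  using assms unfolding m_p_def relatively_p_compact_iff[OF assms(1)]
  by (intro cInf_greatest) (auto simp: lp_norm_nonneg)

lemma m_p_le:
  assumes "y \<in> lp (ereal p)" "K \<subseteq> p_co p y"
  shows "m_p p K \<le> lp_norm (ereal p) y"
  unfolding m_p_def
  by (rule cInf_lower) (use assms in \<open>auto intro!: bdd_belowI[where m = 0] simp: lp_norm_nonneg\<close>)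

text \<open>A bound for \<open>m_p p K\<close> that comes with a witness. It holds for every
  \<open>B\<close> above the infimum, so estimates are made for such \<open>B\<close> and passed to
  the limit afterwards.\<close>

definition p_dominated :: "real \<Rightarrow> real \<Rightarrow> 'b::complex_banach set \<Rightarrow> bool"
  where "p_dominated p B K \<longleftrightarrow> (\<exists>y\<in>lp (ereal p). lp_norm (ereal p) y \<le> B \<and> K \<subseteq> p_co p y)"

lemma p_dominatedI:
  "y \<in> lp (ereal p) \<Longrightarrow> lp_norm (ereal p) y \<le> B \<Longrightarrow> K \<subseteq> p_co p y \<Longrightarrow> p_dominated p B K"
  unfolding p_dominated_def by blast

lemma p_dominated_imp:
  assumes "1 \<le> p" "p_dominated p B K"
  shows "relatively_p_compact p K" "m_p p K \<le> B"
  using assms m_p_le[of _ p K] by (force simp: p_dominated_def relatively_p_compact_iff)+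

lemma p_dominated_above_m_p:
  assumes "1 \<le> p" "relatively_p_compact p K" "m_p p K < B"
  shows "p_dominated p B K"
proof -
  let ?S = "{lp_norm (ereal p) y | y. y \<in> lp (ereal p) \<and> K \<subseteq> p_co p y}"
  have "?S \<noteq> {}"
    using assms relatively_p_compact_iff[OF assms(1)] by blast
  then obtain y where "y \<in> lp (ereal p)" "K \<subseteq> p_co p y" "lp_norm (ereal p) y < B"
    using cInf_lessD[of ?S B] assms(3) unfolding m_p_def by blast
  then show ?thesis
    by (intro p_dominatedI[of y]) auto
qed

lemma p_dominated_subset: "p_dominated p B K \<Longrightarrow> L \<subseteq> K \<Longrightarrow> p_dominated p B L"
  unfolding p_dominated_def by blast

lemma p_dominated_norm_le:
  assumes "1 \<le> p" "p_dominated p B K" "x \<in> K"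
  shows "norm x \<le> B"
  using assms norm_le_lp_norm_p_co[OF assms(1)] by (force simp: p_dominated_def)

lemma norm_le_m_p:
  assumes "1 \<le> p" "relatively_p_compact p K" "x \<in> K"
  shows "norm x \<le> m_p p K"
  by (rule dense_ge) (use p_dominated_norm_le p_dominated_above_m_p assms in blast)

text \<open>The witness is the sequence x, 0, 0, ... with coefficients 1, 0, 0, ...; it makes the
  gauge of a constant equal to its norm.\<close>

lemma p_dominated_singleton:
  fixes x :: "'a::complex_banach"
  assumes "1 \<le> p"
  shows "p_dominated p (norm x) {x}"
proof -
  have "(\<Sum>n<N. norm (if n = 0 then x else 0) powr p) \<le> norm x powr p" for N :: nat
  proof -
    have "(\<Sum>n<N. norm (if n = 0 then x else 0) powr p) = (\<Sum>n<N. if n = 0 then norm x powr p else 0)"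
      by (rule sum.cong) auto
    then show ?thesis
      by (simp add: sum.delta)
  qed
  then have y: "(\<lambda>n. if n = 0 then x else 0) \<in> lp (ereal p)"
      "lp_norm (ereal p) (\<lambda>n. if n = 0 then x else 0) \<le> norm x"
    using lp_norm_le_iff[of p "norm x" "\<lambda>n. if n = 0 then x else 0"] assms by auto
  let ?\<alpha> = "\<lambda>n::nat. if n = 0 then 1 else 0 :: complex"
  have "?\<alpha> \<in> lq_ball p"
  proof (cases "p = 1")
    case False
    have "(\<Sum>n<N. cmod (?\<alpha> n) powr q) = (\<Sum>n<N. if n = 0 then 1 else 0)" for N and q :: real
      by (rule sum.cong) auto
    then show ?thesis
      using assms False by (simp add: lq_ball_gt_one sum.delta)
  qed (simp add: lq_ball_one)
  moreover have "(\<lambda>n. ?\<alpha> n *\<^sub>C (if n = 0 then x else 0)) sums x"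
    using sums_single[of 0 "\<lambda>_. x"] by (rule sums_cong[THEN iffD1, rotated]) (simp add: scaleC_one)
  ultimately have "x \<in> p_co p (\<lambda>n. if n = 0 then x else 0)"
    by (auto simp only: p_co_eq)
  then show ?thesis
    using y by (intro p_dominatedI) auto
qed

lemma p_dominated_scaleC:
  fixes K :: "'a::complex_banach set"
  assumes p: "1 \<le> p" and K: "p_dominated p B K"
  shows "p_dominated p (cmod c * B) ((\<lambda>x. c *\<^sub>C x) ` K)"
proof -
  obtain y where y: "y \<in> lp (ereal p)" "lp_norm (ereal p) y \<le> B" "K \<subseteq> p_co p y"
    using K by (auto simp: p_dominated_def)
  have B: "0 \<le> B"
    using lp_norm_nonneg[of p y] y(2) by simp
  have "(\<Sum>n<N. norm (c *\<^sub>C y n) powr p) \<le> (cmod c * B) powr p" for N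
  proof -
    have "(\<Sum>n<N. norm (c *\<^sub>C y n) powr p) = cmod c powr p * (\<Sum>n<N. norm (y n) powr p)"
      by (simp add: norm_scaleC powr_mult sum_distrib_left)
    also have "\<dots> \<le> cmod c powr p * B powr p"
      using y lp_norm_le_iff[of p B y] p B by (intro mult_left_mono) auto
    finally show ?thesis
      using B by (simp add: powr_mult)
  qed
  then have "(\<lambda>n. c *\<^sub>C y n) \<in> lp (ereal p)" "lp_norm (ereal p) (\<lambda>n. c *\<^sub>C y n) \<le> cmod c * B"
    using lp_norm_le_iff[of p "cmod c * B" "\<lambda>n. c *\<^sub>C y n"] p B by auto
  moreover have "c *\<^sub>C x \<in> p_co p (\<lambda>n. c *\<^sub>C y n)" if "x \<in> K" for x
  proof -
    obtain \<alpha> where \<alpha>: "\<alpha> \<in> lq_ball p" "(\<lambda>n. \<alpha> n *\<^sub>C y n) sums x"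
      using y(3) \<open>x \<in> K\<close> unfolding p_co_eq by blast
    have "(\<lambda>n. c *\<^sub>C (\<alpha> n *\<^sub>C y n)) sums (c *\<^sub>C x)"
      by (rule bounded_linear.sums[OF bounded_linear_scaleC_right \<alpha>(2)])
    then show ?thesis
      using \<alpha>(1) by (auto simp: p_co_eq scaleC_scaleC mult.commute)
  qed
  ultimately show ?thesis
    by (intro p_dominatedI) auto
qed

section \<open>Merging countably many dominating sequences\<close>

text \<open>Finitely many pairs lie in a square, over which the nonnegative terms are summed row by
  row.\<close>

lemma sum_prod_decode_le:
  fixes g :: "nat \<times> nat \<Rightarrow> real"
  assumes g: "\<And>z. 0 \<le> g z" and le: "\<And>j N. (\<Sum>n<N. g (j, n)) \<le> B j" and B: "summable B"
  shows "(\<Sum>k<N. g (prod_decode k)) \<le> suminf B"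
proof -
  have B0: "0 \<le> B j" for j
    using le[of j 0] by simp
  obtain M where M: "prod_decode ` {..<N} \<subseteq> {..<M} \<times> {..<M}"
  proof -
    \<comment> \<open>Both components of a pair are at most its code, so \<open>M = N\<close> is
      large enough.\<close>
    have "prod_decode k \<in> {..<N} \<times> {..<N}" if "k < N" for k
      using that le_prod_encode_1[of "fst (prod_decode k)" "snd (prod_decode k)"]
        le_prod_encode_2[of "snd (prod_decode k)" "fst (prod_decode k)"]
      by (auto simp: mem_Times_iff)
    then show thesis
      using that[of N] by blast
  qed
  have "(\<Sum>k<N. g (prod_decode k)) = sum g (prod_decode ` {..<N})"
    by (subst sum.reindex) (auto intro: inj_on_subset[OF inj_prod_decode])
  also have "\<dots> \<le> sum g ({..<M} \<times> {..<M})"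
    using M g by (intro sum_mono2) auto
  also have "\<dots> = (\<Sum>j<M. \<Sum>n<M. g (j, n))"
    by (simp add: sum.cartesian_product)
  also have "\<dots> \<le> (\<Sum>j<M. B j)"
    by (intro sum_mono le)
  also have "\<dots> \<le> suminf B"
    using B B0 by (intro sum_le_suminf) auto
  finally show ?thesis .
qed

text \<open>Absolute summability makes the sum unordered. It can then be reindexed along the
  bijection \<open>prod_decode\<close> and evaluated by rows.\<close>

lemma sums_prod_decode:
  fixes g :: "nat \<times> nat \<Rightarrow> 'a::banach"
  assumes abs: "summable (\<lambda>k. norm (g (prod_decode k)))"
    and inner: "\<And>j. summable (\<lambda>n. norm (g (j, n)))" "\<And>j. (\<lambda>n. g (j, n)) sums h j"
  shows "summable h" and "(\<lambda>k. g (prod_decode k)) sums suminf h"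
proof -
  obtain s where s: "(\<lambda>k. g (prod_decode k)) sums s"
    using summable_norm_cancel[OF abs] by (auto simp: summable_def)
  have "((\<lambda>k. g (prod_decode k)) has_sum s) UNIV"
    by (rule norm_summable_imp_has_sum[OF abs s])
  then have "(g has_sum s) (UNIV \<times> UNIV)"
    using has_sum_reindex_bij_betw[OF bij_prod_decode, of g s] by simp
  then have "(h has_sum s) UNIV"
    using norm_summable_imp_has_sum[OF inner] by (rule has_sum_SigmaD)
  then have "h sums s"
    by (rule has_sum_imp_sums)
  then show "summable h" "(\<lambda>k. g (prod_decode k)) sums suminf h"
    using s by (auto simp: sums_iff)
qed

text \<open>The families dominating the summands are merged into one sequence \<open>y\<^sub>j\<^sub>n / c\<^sub>j\<close> with
  \<open>c\<^sub>j = (A\<^sub>j / \<Sum>A)\<^bsup>1/q\<^esup>\<close>; these weights turn Hoelder's inequality between the blocks into an equality,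
  so that no constant is lost.\<close>

lemma p_dominated_suminf:
  fixes f :: "nat \<Rightarrow> 'i \<Rightarrow> 'a::complex_banach"
  assumes p: "1 \<le> p" and A: "\<And>j. 0 < A j" "summable A"
    and f: "\<And>j. p_dominated p (A j) (f j ` I)"
  shows "\<And>x. x \<in> I \<Longrightarrow> summable (\<lambda>j. f j x)"
    and "p_dominated p (suminf A) ((\<lambda>x. \<Sum>j. f j x) ` I)"
proof -
  define S where "S = suminf A"
  define c where "c j = (A j / S) powr ((p - 1) / p)" for j
  have S: "0 < S"
    using A by (simp add: S_def suminf_pos)
  then have c: "0 < c j" for j
    using A(1)[of j] by (simp add: c_def)
  obtain y where y: "\<And>j. y j \<in> lp (ereal p)" "\<And>j. lp_norm (ereal p) (y j) \<le> A j"
      "\<And>j. f j ` I \<subseteq> p_co p (y j)"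
    using f unfolding p_dominated_def by metis
  define w where "w k = (case prod_decode k of (j, n) \<Rightarrow> complex_of_real (1 / c j) *\<^sub>C y j n)" for k
  \<comment> \<open>Block \<open>j\<close> contributes at most
    \<open>A j powr p / c j powr p\<close>, which equals \<open>S powr (p - 1) * A j\<close>; these
    bounds add up to \<open>S powr p\<close>.\<close>
  have "(\<Sum>k<N. norm (w k) powr p) \<le> S powr p" for N
  proof -
    have "(\<Sum>n<N. norm (complex_of_real (1 / c j) *\<^sub>C y j n) powr p) \<le> S powr (p - 1) * A j" for j N
    proof -
      have cp: "c j powr p = (A j / S) powr (p - 1)"
        using p by (simp add: c_def powr_powr)
      have "(\<Sum>n<N. norm (complex_of_real (1 / c j) *\<^sub>C y j n) powr p) = (\<Sum>n<N. norm (y j n) powr p) / c j powr p"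
        using c[of j] by (simp add: norm_scaleC norm_divide powr_divide sum_divide_distrib)
      also have "\<dots> \<le> A j powr p / c j powr p"
        using lp_norm_le_iff[of p "A j" "y j"] y[of j] p A(1)[of j] by (intro divide_right_mono) auto
      also have "\<dots> = A j powr p / A j powr (p - 1) * S powr (p - 1)"
        using S A(1)[of j] by (simp add: cp powr_divide)
      also have "\<dots> = S powr (p - 1) * A j"
        using A(1)[of j] by (simp flip: powr_diff)
      finally show ?thesis .
    qed
    then have "(\<Sum>k<N. (\<lambda>(j, n). norm (complex_of_real (1 / c j) *\<^sub>C y j n) powr p) (prod_decode k))
        \<le> (\<Sum>j. S powr (p - 1) * A j)"
      by (intro sum_prod_decode_le) (auto intro: summable_mult A)
    also have "\<dots> = S powr p"
      using S suminf_mult[OF A(2), of "S powr (p - 1)"] powr_add[of S "p - 1" 1] by (simp add: S_def)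
    finally show ?thesis
      by (simp add: w_def case_prod_unfold)
  qed
  then have w: "w \<in> lp (ereal p)" "lp_norm (ereal p) w \<le> S"
    using lp_norm_le_iff[of p S w] p S by auto
  have *: "summable (\<lambda>j. f j x) \<and> (\<Sum>j. f j x) \<in> p_co p w" if "x \<in> I" for x
  proof -
    have "\<forall>j. \<exists>\<alpha>\<in>lq_ball p. (\<lambda>n. \<alpha> n *\<^sub>C y j n) sums f j x"
      using y(3) that by (auto simp: p_co_eq image_subset_iff)
    then obtain \<alpha> where \<alpha>: "\<And>j. \<alpha> j \<in> lq_ball p" "\<And>j. (\<lambda>n. \<alpha> j n *\<^sub>C y j n) sums f j x"
      by metis
    \<comment> \<open>The factor \<open>c j\<close> cancels the factor \<open>1 / c j\<close> in
      \<open>w\<close>. For \<open>p > 1\<close> block \<open>j\<close> has q-th power sum at most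
      \<open>A j / S\<close>, and these bounds add up to 1.\<close>
    define \<beta> where "\<beta> k = (case prod_decode k of (j, n) \<Rightarrow> complex_of_real (c j) * \<alpha> j n)" for k
    have \<beta>: "\<beta> \<in> lq_ball p"
    proof (cases "p = 1")
      \<comment> \<open>The exponent in \<open>c\<close> is now 0, so all weights are 1; strict
        positivity of \<open>A\<close> rules out the value \<open>0 powr 0 = 0\<close>.\<close>
      case True
      then show ?thesis
        using \<alpha>(1) S A(1) by (auto simp: lq_ball_one \<beta>_def c_def norm_mult less_imp_neq split: prod.split)
    next
      case False
      define q where "q = p / (p - 1)"
      have "1 < p"
        using False p by simp
      have cq: "c j powr q = A j / S" for j
        using \<open>1 < p\<close> A(1)[of j] S by (simp add: c_def powr_powr q_def)
      have "(\<Sum>n<N. cmod (complex_of_real (c j) * \<alpha> j n) powr q) \<le> A j / S" for j N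
      proof -
        have "(\<Sum>n<N. cmod (complex_of_real (c j) * \<alpha> j n) powr q) = A j / S * (\<Sum>n<N. cmod (\<alpha> j n) powr q)"
          using c[of j] by (simp add: norm_mult powr_mult sum_distrib_left cq)
        also have "\<dots> \<le> A j / S * 1"
          using \<alpha>(1)[of j] \<open>1 < p\<close> A(1)[of j] S by (intro mult_left_mono) (auto simp: lq_ball_gt_one q_def)
        finally show ?thesis
          by simp
      qed
      then have "(\<Sum>k<N. (\<lambda>(j, n). cmod (complex_of_real (c j) * \<alpha> j n) powr q) (prod_decode k)) \<le> (\<Sum>j. A j / S)" for N
        by (intro sum_prod_decode_le) (auto intro: summable_divide A)
      then show ?thesis
        using S \<open>1 < p\<close> suminf_divide[OF A(2), of S]
        by (simp add: lq_ball_gt_one \<beta>_def case_prod_unfold q_def S_def)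
    qed
    define g where "g = (\<lambda>(j, n). \<alpha> j n *\<^sub>C y j n)"
    have g: "\<beta> k *\<^sub>C w k = g (prod_decode k)" for k
    proof -
      obtain j n where "prod_decode k = (j, n)"
        by fastforce
      then show ?thesis
        using c[of j] by (simp add: \<beta>_def w_def g_def scaleC_scaleC flip: of_real_mult)
    qed
    have "summable (\<lambda>k. norm (g (prod_decode k)))"
      using Holder_lq_ball(1)[OF p \<beta> w(1)] by (simp add: g)
    moreover have "summable (\<lambda>n. norm (g (j, n)))" for j
      using Holder_lq_ball(1)[OF p \<alpha>(1) y(1)] by (simp add: g_def)
    moreover have "(\<lambda>n. g (j, n)) sums f j x" for j
      using \<alpha>(2) by (simp add: g_def)
    ultimately have "summable (\<lambda>j. f j x)" "(\<lambda>k. \<beta> k *\<^sub>C w k) sums (\<Sum>j. f j x)"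
      unfolding g by (fact sums_prod_decode)+
    then show ?thesis
      using \<beta> by (auto simp: p_co_eq)
  qed
  then show "\<And>x. x \<in> I \<Longrightarrow> summable (\<lambda>j. f j x)"
    by blast
  show "p_dominated p (suminf A) ((\<lambda>x. \<Sum>j. f j x) ` I)"
    using * w by (intro p_dominatedI) (auto simp: S_def)
qed

section \<open>Polarization\<close>

lemma complex_linear_iff:
  "Vector_Spaces.linear scaleC scaleC (f :: 'a::complex_banach \<Rightarrow> 'b::complex_banach) \<longleftrightarrow>
    (\<forall>x y. f (x + y) = f x + f y) \<and> (\<forall>c x. f (c *\<^sub>C x) = c *\<^sub>C f x)"
  by (simp add: Vector_Spaces.linear_iff vector_space_scaleC)

lemma multilinear_map_cong:
  "multilinear_map m A \<Longrightarrow> (\<And>i. i < m \<Longrightarrow> x i = y i) \<Longrightarrow> A x = A y"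
  unfolding multilinear_map_def by blast

lemma multilinear_map_iff:
  "multilinear_map m A \<longleftrightarrow> (\<forall>x y. (\<forall>i<m. x i = y i) \<longrightarrow> A x = A y) \<and>
    (\<forall>i<m. \<forall>x u v. A (x(i := u + v)) = A (x(i := u)) + A (x(i := v))) \<and>
    (\<forall>i<m. \<forall>x c u. A (x(i := c *\<^sub>C u)) = c *\<^sub>C A (x(i := u)))"
  unfolding multilinear_map_def complex_linear_iff by blast

lemma multilinear_map_add_at:
  "multilinear_map m A \<Longrightarrow> i < m \<Longrightarrow> A (x(i := u + v)) = A (x(i := u)) + A (x(i := v))"
  unfolding multilinear_map_iff by blast

lemma multilinear_map_scaleC_at:
  "multilinear_map m A \<Longrightarrow> i < m \<Longrightarrow> A (x(i := c *\<^sub>C u)) = c *\<^sub>C A (x(i := u))"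
  unfolding multilinear_map_iff by blast

lemma multilinear_map_sum_at:
  assumes "multilinear_map m A" "i < m"
  shows "A (x(i := (\<Sum>j\<in>J. g j))) = (\<Sum>j\<in>J. A (x(i := g j)))"
proof -
  have zero: "A (x(i := 0)) = 0"
    using multilinear_map_scaleC_at[OF assms, of x 0 0] by simp
  show ?thesis
    by (induction J rule: infinite_finite_induct)
      (simp_all only: sum.infinite sum.empty sum.insert zero multilinear_map_add_at[OF assms] not_False_eq_True)
qed

lemma multilinear_map_scaleC_all:
  assumes A: "multilinear_map m A"
  shows "A (\<lambda>i. c i *\<^sub>C x i) = (\<Prod>i<m. c i) *\<^sub>C A x"
proof -
  have "A (\<lambda>i. if i < k then c i *\<^sub>C x i else x i) = (\<Prod>i<k. c i) *\<^sub>C A x" if "k \<le> m" for k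
    using that
  proof (induction k)
    case (Suc k)
    let ?x = "\<lambda>i. if i < k then c i *\<^sub>C x i else x i"
    have "(\<lambda>i. if i < Suc k then c i *\<^sub>C x i else x i) = ?x(k := c k *\<^sub>C x k)"
      by (auto simp: fun_eq_iff less_Suc_eq)
    moreover have "?x(k := x k) = ?x"
      by auto
    ultimately show ?case
      using Suc multilinear_map_scaleC_at[OF A, of k ?x "c k" "x k"]
      by (simp add: scaleC_scaleC mult.commute)
  qed (simp add: scaleC_one)
  from this[of m] show ?thesis
    using multilinear_map_cong[OF A, of "\<lambda>i. c i *\<^sub>C x i" "\<lambda>i. if i < m then c i *\<^sub>C x i else x i"] by simp
qed

text \<open>The distributive law, where \<open>f\<close> selects one summand for each slot. The
  induction expands the slots below \<open>k\<close> and keeps the other entries \<open>w\<close>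
  arbitrary, so that the next sum can be hidden in \<open>w\<close>.\<close>

lemma multilinear_map_expand:
  assumes A: "multilinear_map m A" and J: "\<And>i. finite (J i)"
  shows "A (\<lambda>i. \<Sum>j\<in>J i. g i j) = (\<Sum>f\<in>PiE {..<m} J. A (\<lambda>i. g i (f i)))"
proof -
  have "A (\<lambda>i. if i < k then \<Sum>j\<in>J i. g i j else w i) =
      (\<Sum>f\<in>PiE {..<k} J. A (\<lambda>i. if i < k then g i (f i) else w i))" if "k \<le> m" for k w
    using that
  proof (induction k arbitrary: w)
    case (Suc k)
    define s where "s = (\<Sum>j\<in>J k. g k j)"
    have "A (\<lambda>i. if i < Suc k then \<Sum>j\<in>J i. g i j else w i) =
        A (\<lambda>i. if i < k then \<Sum>j\<in>J i. g i j else (w(k := s)) i)"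
      by (rule arg_cong[of _ _ A]) (auto simp: s_def less_Suc_eq)
    also have "\<dots> = (\<Sum>f\<in>PiE {..<k} J. A (\<lambda>i. if i < k then g i (f i) else (w(k := s)) i))"
      using Suc by simp
    also have "\<dots> = (\<Sum>f\<in>PiE {..<k} J. A ((\<lambda>i. if i < k then g i (f i) else w i)(k := s)))"
      by (intro sum.cong refl arg_cong[of _ _ A] ext) simp
    also have "\<dots> = (\<Sum>f\<in>PiE {..<k} J. \<Sum>j\<in>J k. A ((\<lambda>i. if i < k then g i (f i) else w i)(k := g k j)))"
      using Suc.prems unfolding s_def by (simp add: multilinear_map_sum_at[OF A])
    also have "\<dots> = (\<Sum>f\<in>PiE {..<k} J. \<Sum>j\<in>J k. A (\<lambda>i. if i < Suc k then g i ((f(k := j)) i) else w i))"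
      by (intro sum.cong refl arg_cong[of _ _ A] ext) (simp add: less_Suc_eq)
    also have "\<dots> = (\<Sum>(j, f)\<in>J k \<times> PiE {..<k} J. A (\<lambda>i. if i < Suc k then g i ((f(k := j)) i) else w i))"
      by (subst sum.swap) (rule sum.cartesian_product)
    also have "\<dots> = (\<Sum>f\<in>PiE (insert k {..<k}) J. A (\<lambda>i. if i < Suc k then g i (f i) else w i))"
      unfolding PiE_insert_eq
      by (subst sum.reindex[OF inj_combinator]) (auto simp: case_prod_unfold)
    finally show ?case
      by (simp add: lessThan_Suc)
  qed simp
  \<comment> \<open>The entry 0 is a filler for the slots from \<open>m\<close> on, which
    \<open>A\<close> ignores.\<close>
  note expand = this[of m "\<lambda>_. 0"]
  have "A (\<lambda>i. \<Sum>j\<in>J i. g i j) = A (\<lambda>i. if i < m then \<Sum>j\<in>J i. g i j else 0)"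
    by (rule multilinear_map_cong[OF A]) simp
  also have "\<dots> = (\<Sum>f\<in>PiE {..<m} J. A (\<lambda>i. if i < m then g i (f i) else 0))"
    by (simp add: expand)
  also have "\<dots> = (\<Sum>f\<in>PiE {..<m} J. A (\<lambda>i. g i (f i)))"
    by (intro sum.cong refl multilinear_map_cong[OF A]) simp
  finally show ?thesis .
qed

text \<open>Slots outside \<open>S\<close> are frozen at \<open>a\<close> and those in
  \<open>S\<close> are renumbered by \<open>h\<close>. Since \<open>h\<close> is bijective, updating
  argument \<open>k\<close> updates exactly one slot of \<open>A\<close>. This covers both slot
  permutations and the terms of a Taylor expansion.\<close>

lemma multilinear_map_substitute:
  assumes A: "multilinear_map m A" and S: "S \<subseteq> {..<m}" and h: "bij_betw h S {..<l}"
  shows "multilinear_map l (\<lambda>x. A (\<lambda>i. if i \<in> S then x (h i) else a))"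
proof -
  have upd: "\<exists>j<m. \<forall>x z. (\<lambda>i. if i \<in> S then (x(k := z)) (h i) else a) =
      (\<lambda>i. if i \<in> S then x (h i) else a)(j := z)" if k: "k < l" for k
  proof -
    obtain j where j: "j \<in> S" "h j = k"
      using h k by (metis bij_betw_def imageE lessThan_iff)
    have iff: "h i = k \<longleftrightarrow> i = j" if "i \<in> S" for i
      using h j that by (auto simp: bij_betw_def dest: inj_onD)
    have "(\<lambda>i. if i \<in> S then (x(k := z)) (h i) else a) = (\<lambda>i. if i \<in> S then x (h i) else a)(j := z)" for x z
      using j(1) by (intro ext) (simp add: iff)
    then show ?thesis
      using j(1) S by blast
  qed
  show ?thesis
    unfolding multilinear_map_def
  proof (intro conjI allI impI)
    fix x y :: "nat \<Rightarrow> 'a"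
    assume "\<forall>i<l. x i = y i"
    then show "A (\<lambda>i. if i \<in> S then x (h i) else a) = A (\<lambda>i. if i \<in> S then y (h i) else a)"
      using h by (intro arg_cong[of _ _ A]) (auto simp: fun_eq_iff bij_betw_def)
  next
    fix k and x :: "nat \<Rightarrow> 'a"
    assume "k < l"
    then obtain j where j: "j < m" "\<And>z. (\<lambda>i. if i \<in> S then (x(k := z)) (h i) else a) =
        (\<lambda>i. if i \<in> S then x (h i) else a)(j := z)"
      using upd by blast
    show "Vector_Spaces.linear scaleC scaleC (\<lambda>z. A (\<lambda>i. if i \<in> S then (x(k := z)) (h i) else a))"
      unfolding j(2) using A j(1) by (simp add: multilinear_map_def)
  qed
qed

lemma multilinear_map_zero: "multilinear_map m (\<lambda>_. 0)"
  by (simp add: multilinear_map_iff)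

lemma multilinear_map_add:
  "multilinear_map m A \<Longrightarrow> multilinear_map m B \<Longrightarrow> multilinear_map m (\<lambda>x. A x + B x)"
  unfolding multilinear_map_iff by (auto simp: scaleC_add_right) metis+

lemma multilinear_map_scaleC:
  "multilinear_map m A \<Longrightarrow> multilinear_map m (\<lambda>x. c *\<^sub>C A x)"
  unfolding multilinear_map_iff by (auto simp: scaleC_add_right scaleC_scaleC mult.commute)

lemma multilinear_map_sum:
  "(\<And>j. j \<in> J \<Longrightarrow> multilinear_map m (A j)) \<Longrightarrow> multilinear_map m (\<lambda>x. \<Sum>j\<in>J. A j x)"
  by (induction J rule: infinite_finite_induct) (auto intro: multilinear_map_zero multilinear_map_add)

text \<open>Each defining identity involves finitely many values, hence survives pointwise
  limits.\<close>

lemma multilinear_map_limit: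
  assumes A: "\<And>n. multilinear_map m (A n)" and lim: "\<And>x. (\<lambda>n. A n x) \<longlonglongrightarrow> L x"
  shows "multilinear_map m L"
  unfolding multilinear_map_iff
proof (intro conjI allI impI)
  show "L x = L y" if "\<forall>i<m. x i = y i" for x y
  proof -
    have "(\<lambda>n. A n x) = (\<lambda>n. A n y)"
      using that multilinear_map_cong[OF A] by blast
    then show ?thesis
      using LIMSEQ_unique[OF lim[of x]] lim[of y] by simp
  qed
  show "L (x(i := u + v)) = L (x(i := u)) + L (x(i := v))" if "i < m" for i x u v
    using LIMSEQ_unique[OF lim[of "x(i := u + v)"]] tendsto_add[OF lim lim]
    by (simp add: multilinear_map_add_at[OF A that])
  show "L (x(i := c *\<^sub>C u)) = c *\<^sub>C L (x(i := u))" if "i < m" for i x c u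
    using LIMSEQ_unique[OF lim[of "x(i := c *\<^sub>C u)"]] tendsto_scaleC[OF lim]
    by (simp add: multilinear_map_scaleC_at[OF A that])
qed

section \<open>The polarization formula\<close>

text \<open>The alternating sum of the polarization formula without its factor 1/m!. The sign
  (-1)^(m - card S) is split into a product to avoid subtraction.\<close>

definition polarization :: "nat \<Rightarrow> ('a::complex_banach \<Rightarrow> 'b::complex_banach) \<Rightarrow> (nat \<Rightarrow> 'a) \<Rightarrow> 'b"
  where "polarization m P x =
    (\<Sum>S\<in>Pow {..<m}. ((-1) ^ m * (-1) ^ card S) *\<^sub>C P (\<Sum>i\<in>S. x i))"

text \<open>Between a proper subset \<open>U\<close> and \<open>M\<close> there are as many sets of
  even as of odd cardinality, so the signs cancel.\<close>

lemma sum_supersets_alternating: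
  assumes "finite M" "U \<subseteq> M"
  shows "(\<Sum>S\<in>Pow M. if U \<subseteq> S then (-1) ^ card S else (0::'a::ring_1)) = (if U = M then (-1) ^ card M else 0)"
proof -
  have "(\<Sum>S\<in>Pow M. if U \<subseteq> S then (-1) ^ card S else (0::'a)) = (\<Sum>S\<in>{S. S \<subseteq> M \<and> U \<subseteq> S}. (-1) ^ card S)"
    using assms by (intro sum.mono_neutral_cong_right) auto
  also have "\<dots> = (if U = M then (-1) ^ card M else 0)"
  proof (cases "U = M")
    case True
    then have "{S. S \<subseteq> M \<and> U \<subseteq> S} = {M}"
      by auto
    then show ?thesis
      using True by simp
  next
    case False
    then have "(\<Sum>S\<in>{S. S \<subseteq> M \<and> U \<subseteq> S}. (-1) ^ card S) = (0::'a)"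
      using card_subsupersets_even_odd[of M U] assms
      by (intro sum_alternating_cancels) (auto simp: conj_assoc)
    then show ?thesis
      using False by simp
  qed
  finally show ?thesis .
qed

text \<open>The permutations of m slots, given as surjective extensional maps so that they are part
  of the index set produced by \<open>multilinear_map_expand\<close>.\<close>

definition symmetries :: "nat \<Rightarrow> (nat \<Rightarrow> nat) set"
  where "symmetries m = {f \<in> PiE {..<m} (\<lambda>_. {..<m}). f ` {..<m} = {..<m}}"

lemma finite_symmetries: "finite (symmetries m)"
  by (simp add: symmetries_def finite_PiE)

lemma card_symmetries_pos: "0 < card (symmetries m)"
proof -
  have "restrict id {..<m} \<in> symmetries m"
    by (auto simp: symmetries_def)
  then show ?thesis
    using finite_symmetries card_gt_0_iff by blast
qed

text \<open>Expanding the value at each \<open>S\<close> yields a sum over maps \<open>f\<close>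
  into \<open>S\<close>. After exchanging the sums, the coefficient of \<open>f\<close> is an
  alternating sum over the supersets of its range, which is 0 unless \<open>f\<close> is
  onto.\<close>

lemma polarization_multilinear_map:
  assumes A: "multilinear_map m A"
  shows "polarization m (\<lambda>x. A (\<lambda>_. x)) x = (\<Sum>f\<in>symmetries m. A (\<lambda>i. x (f i)))"
proof -
  let ?M = "{..<m}" and ?F = "PiE {..<m} (\<lambda>_. {..<m})"
  have finF: "finite ?F"
    by (intro finite_PiE) auto
  \<comment> \<open>An indicator coefficient makes the index set of maps independent of
    \<open>S\<close>, which permits the exchange of sums.\<close>
  have expand: "A (\<lambda>_. \<Sum>i\<in>S. x i) = (\<Sum>f\<in>?F. (if f ` ?M \<subseteq> S then 1 else 0) *\<^sub>C A (\<lambda>i. x (f i)))"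
    if "S \<subseteq> ?M" for S
  proof -
    have "A (\<lambda>_. \<Sum>i\<in>S. x i) = (\<Sum>f\<in>PiE ?M (\<lambda>_. S). A (\<lambda>i. x (f i)))"
      using that multilinear_map_expand[OF A, of "\<lambda>_. S" "\<lambda>_ j. x j"] finite_subset by blast
    also have "\<dots> = (\<Sum>f\<in>?F. (if f ` ?M \<subseteq> S then 1 else 0) *\<^sub>C A (\<lambda>i. x (f i)))"
      using that finF
      by (intro sum.mono_neutral_cong_left) (auto simp: scaleC_one PiE_iff image_subset_iff)
    finally show ?thesis .
  qed
  have "polarization m (\<lambda>x. A (\<lambda>_. x)) x =
      (\<Sum>S\<in>Pow ?M. \<Sum>f\<in>?F. ((-1) ^ m * (if f ` ?M \<subseteq> S then (-1) ^ card S else 0)) *\<^sub>C A (\<lambda>i. x (f i)))"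
    unfolding polarization_def
  proof (rule sum.cong)
    fix S
    assume "S \<in> Pow ?M"
    then show "((-1) ^ m * (-1) ^ card S) *\<^sub>C A (\<lambda>_. \<Sum>i\<in>S. x i) =
        (\<Sum>f\<in>?F. ((-1) ^ m * (if f ` ?M \<subseteq> S then (-1) ^ card S else 0)) *\<^sub>C A (\<lambda>i. x (f i)))"
      by (simp add: expand scaleC.scale_sum_right scaleC_scaleC cong: if_cong)
        (intro sum.cong, auto)
  qed simp
  also have "\<dots> = (\<Sum>f\<in>?F. \<Sum>S\<in>Pow ?M. ((-1) ^ m * (if f ` ?M \<subseteq> S then (-1) ^ card S else 0)) *\<^sub>C A (\<lambda>i. x (f i)))"
    by (rule sum.swap)
  also have "\<dots> = (\<Sum>f\<in>?F. (if f ` ?M = ?M then 1 else 0) *\<^sub>C A (\<lambda>i. x (f i)))"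
  proof (rule sum.cong)
    fix f
    assume "f \<in> ?F"
    then have "f ` ?M \<subseteq> ?M"
      by auto
    then have "(\<Sum>S\<in>Pow ?M. (-1) ^ m * (if f ` ?M \<subseteq> S then (-1) ^ card S else (0::complex))) = (if f ` ?M = ?M then 1 else 0)"
      using sum_supersets_alternating[of ?M "f ` ?M", where 'a = complex]
      by (simp flip: sum_distrib_left power_add)
    then show "(\<Sum>S\<in>Pow ?M. ((-1) ^ m * (if f ` ?M \<subseteq> S then (-1) ^ card S else 0)) *\<^sub>C A (\<lambda>i. x (f i))) =
        (if f ` ?M = ?M then 1 else 0) *\<^sub>C A (\<lambda>i. x (f i))"
      by (simp only: flip: scaleC.scale_sum_left)
  qed simp
  also have "\<dots> = (\<Sum>f\<in>symmetries m. A (\<lambda>i. x (f i)))"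
    using finF by (intro sum.mono_neutral_cong_right) (auto simp: symmetries_def scaleC_one)
  finally show ?thesis .
qed

lemma multilinear_map_polarization:
  assumes A: "multilinear_map m A"
  shows "multilinear_map m (polarization m (\<lambda>x. A (\<lambda>_. x)))"
  unfolding polarization_multilinear_map[OF A, abs_def]
proof (rule multilinear_map_sum)
  fix f
  assume "f \<in> symmetries m"
  then have "f ` {..<m} = {..<m}"
    by (simp add: symmetries_def)
  then have "bij_betw f {..<m} {..<m}"
    by (simp add: bij_betw_def eq_card_imp_inj_on)
  then have "multilinear_map m (\<lambda>x. A (\<lambda>i. if i \<in> {..<m} then x (f i) else 0))"
    by (intro multilinear_map_substitute[OF A]) auto
  moreover have "(\<lambda>x. A (\<lambda>i. if i \<in> {..<m} then x (f i) else 0)) = (\<lambda>x. A (\<lambda>i. x (f i)))"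
    by (intro ext multilinear_map_cong[OF A]) auto
  ultimately show "multilinear_map m (\<lambda>x. A (\<lambda>i. x (f i)))"
    by simp
qed

section \<open>Spaces of homogeneous polynomials\<close>

lemma hpolyE:
  assumes "P \<in> hpoly m"
  obtains A where "multilinear_map m A" "P = (\<lambda>x. A (\<lambda>_. x))" "continuous_on UNIV P"
  using assms by (auto simp: hpoly_def fun_eq_iff)

lemma hpolyI:
  "multilinear_map m A \<Longrightarrow> (\<And>x. P x = A (\<lambda>_. x)) \<Longrightarrow> continuous_on UNIV P \<Longrightarrow> P \<in> hpoly m"
  by (auto simp: hpoly_def)

text \<open>The multilinear maps representing the \<open>X n\<close> need not converge, but their polarizations, which are
  finite sums of values of \<open>X n\<close>, do.\<close>

lemma hpoly_limit:
  assumes X: "\<And>n. X n \<in> hpoly m" and lim: "\<And>x. (\<lambda>n. X n x) \<longlonglongrightarrow> L x"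
    and cont: "continuous_on UNIV L"
  shows "L \<in> hpoly m"
proof (rule hpolyI[OF _ _ cont])
  define N where "N = complex_of_nat (card (symmetries m))"
  have N: "N \<noteq> 0"
    using card_symmetries_pos[of m] by (simp add: N_def)
  \<comment> \<open>On the diagonal all permuted copies of a representing map agree, so polarization
    multiplies \<open>X n\<close> by the number \<open>N\<close> of permutations.\<close>
  have X: "multilinear_map m (polarization m (X n))" "polarization m (X n) (\<lambda>_. x) = N *\<^sub>C X n x" for n x
  proof -
    obtain A where A: "multilinear_map m A" "X n = (\<lambda>x. A (\<lambda>_. x))"
      using X[of n] by (elim hpolyE)
    show "multilinear_map m (polarization m (X n))"
      unfolding A(2) by (rule multilinear_map_polarization[OF A(1)])
    show "polarization m (X n) (\<lambda>_. x) = N *\<^sub>C X n x"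
      unfolding A(2) polarization_multilinear_map[OF A(1)] by (simp add: N_def scaleC.sum_constant_scale)
  qed
  have pol: "(\<lambda>n. polarization m (X n) x) \<longlonglongrightarrow> polarization m L x" for x
    unfolding polarization_def by (intro tendsto_sum tendsto_scaleC lim)
  show "multilinear_map m (\<lambda>x. (1 / N) *\<^sub>C polarization m L x)"
    by (intro multilinear_map_scaleC multilinear_map_limit[OF X(1) pol])
  have "polarization m L (\<lambda>_. x) = N *\<^sub>C L x" for x
    using LIMSEQ_unique[OF pol[of "\<lambda>_. x"]] tendsto_scaleC[OF lim] by (simp add: X(2))
  then show "L x = (1 / N) *\<^sub>C polarization m L (\<lambda>_. x)" for x
    using N by (simp add: scaleC_scaleC scaleC_one)
qed

lemma hpoly_homogeneous:
  assumes "P \<in> hpoly m"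
  shows "P (c *\<^sub>C x) = c ^ m *\<^sub>C P x"
proof -
  obtain A where "multilinear_map m A" "P = (\<lambda>x. A (\<lambda>_. x))"
    using assms by (elim hpolyE)
  then show ?thesis
    using multilinear_map_scaleC_all[of m A "\<lambda>_. c" "\<lambda>_. x"] by simp
qed

lemma complex_subspace_hpoly: "complex_subspace (hpoly m)"
  unfolding complex_subspace_def
proof (intro conjI ballI allI)
  show "(\<lambda>_. 0) \<in> hpoly m"
    by (rule hpolyI[OF multilinear_map_zero]) auto
next
  fix P Q :: "'a \<Rightarrow> 'b"
  assume "P \<in> hpoly m" "Q \<in> hpoly m"
  then obtain A B where "multilinear_map m A" "P = (\<lambda>x. A (\<lambda>_. x))" "continuous_on UNIV P"
      "multilinear_map m B" "Q = (\<lambda>x. B (\<lambda>_. x))" "continuous_on UNIV Q"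
    by (elim hpolyE)
  then show "(\<lambda>x. P x + Q x) \<in> hpoly m"
    by (intro hpolyI[OF multilinear_map_add[of m A B]] continuous_on_add) auto
next
  fix c and P :: "'a \<Rightarrow> 'b"
  assume "P \<in> hpoly m"
  then show "(\<lambda>x. c *\<^sub>C P x) \<in> hpoly m"
    by (elim hpolyE) (auto intro!: hpolyI[OF multilinear_map_scaleC] continuous_intros)
qed

lemma hpoly_0: "(hpoly 0 :: ('a::complex_banach \<Rightarrow> 'b::complex_banach) set) = range (\<lambda>c _. c)"
proof
  show "(hpoly 0 :: ('a \<Rightarrow> 'b) set) \<subseteq> range (\<lambda>c _. c)"
  proof
    fix P :: "'a \<Rightarrow> 'b"
    assume "P \<in> hpoly 0"
    then have "P = (\<lambda>_. P 0)"
      by (elim hpolyE) (auto simp: fun_eq_iff intro: multilinear_map_cong)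
    then show "P \<in> range (\<lambda>c _. c)"
      using rangeI[of "\<lambda>c _. c" "P 0"] by simp
  qed
  have "(\<lambda>_::'a. c) \<in> hpoly 0" for c :: 'b
    by (rule hpolyI[of 0 "\<lambda>_. c"]) (simp_all add: multilinear_map_iff)
  then show "range (\<lambda>c _. c) \<subseteq> (hpoly 0 :: ('a \<Rightarrow> 'b) set)"
    by blast
qed

section \<open>Taylor components\<close>

text \<open>Each slot of the representing map receives either \<open>z\<close> or \<open>a\<close>;
  the choices are grouped by the number \<open>k\<close> of slots that receive \<open>z\<close>. The
  other \<open>m - k\<close> slots hold \<open>a\<close> and account for the homogeneity in
  \<open>a\<close>.\<close>

lemma hpoly_taylor_expansion:
  fixes P :: "'a::complex_banach \<Rightarrow> 'b::complex_banach"
  assumes "P \<in> hpoly m"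
  obtains T B where
    "\<And>a k. k \<le> m \<Longrightarrow> multilinear_map k (B a k)"
    "\<And>a k z. k \<le> m \<Longrightarrow> T a k z = B a k (\<lambda>_. z)"
    "\<And>a z. P (a + z) = (\<Sum>k\<le>m. T a k z)"
    "\<And>a k z c. k \<le> m \<Longrightarrow> T (c *\<^sub>C a) k z = c ^ (m - k) *\<^sub>C T a k z"
proof -
  obtain A where A: "multilinear_map m A" and P: "P = (\<lambda>x. A (\<lambda>_. x))"
    using assms by (elim hpolyE)
  define G where "G = PiE {..<m} (\<lambda>_. UNIV :: bool set)"
  define pos where "pos f = {i. i < m \<and> f i}" for f
  \<comment> \<open>An arbitrary numbering of the chosen slots, which turns them into the arguments
    of a \<open>k\<close>-linear map.\<close>
  define h where "h S = (SOME h. bij_betw h S {..<card S})" for S :: "nat set"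
  define T where "T a k z = (\<Sum>f\<in>{f\<in>G. card (pos f) = k}. A (\<lambda>i. if i \<in> pos f then z else a))" for a k z
  define B where "B a k x = (\<Sum>f\<in>{f\<in>G. card (pos f) = k}. A (\<lambda>i. if i \<in> pos f then x (h (pos f) i) else a))" for a k x
  have finG: "finite G"
    by (simp add: G_def finite_PiE)
  have pos: "pos f \<subseteq> {..<m}" "finite (pos f)" for f
    by (auto simp: pos_def)
  have h: "bij_betw (h (pos f)) (pos f) {..<card (pos f)}" for f
    unfolding h_def
    by (rule someI_ex[of "\<lambda>h. bij_betw h (pos f) {..<card (pos f)}"])
      (rule ex_bij_betw_finite_nat[OF pos(2), unfolded atLeast0LessThan])
  show thesis
  proof
    show "multilinear_map k (B a k)" for a k
      unfolding B_def[abs_def]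
    proof (rule multilinear_map_sum)
      fix f
      assume "f \<in> {f \<in> G. card (pos f) = k}"
      then show "multilinear_map k (\<lambda>x. A (\<lambda>i. if i \<in> pos f then x (h (pos f) i) else a))"
        using multilinear_map_substitute[OF A pos(1) h[of f]] by simp
    qed
    show "T a k z = B a k (\<lambda>_. z)" for a k z
      by (simp add: T_def B_def)
    show "P (a + z) = (\<Sum>k\<le>m. T a k z)" for a z
    proof -
      have card_le: "card (pos f) \<le> m" for f
        using card_mono[OF _ pos(1)] by simp
      \<comment> \<open>The sum of \<open>a\<close> and \<open>z\<close> is written over the
        booleans to fit \<open>multilinear_map_expand\<close>.\<close>
      have "P (a + z) = A (\<lambda>i. \<Sum>b\<in>UNIV. if b then z else a)"
        by (simp add: P UNIV_bool add.commute)
      also have "\<dots> = (\<Sum>f\<in>G. A (\<lambda>i. if f i then z else a))"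
        unfolding G_def by (rule multilinear_map_expand[OF A]) simp
      also have "\<dots> = (\<Sum>f\<in>G. A (\<lambda>i. if i \<in> pos f then z else a))"
        by (intro sum.cong refl multilinear_map_cong[OF A]) (simp add: pos_def)
      also have "\<dots> = (\<Sum>k\<le>m. T a k z)"
        unfolding T_def using finG card_le by (intro sum.group[symmetric]) auto
      finally show ?thesis .
    qed
    show "T (c *\<^sub>C a) k z = c ^ (m - k) *\<^sub>C T a k z" if "k \<le> m" for a k z c
    proof -
      have "A (\<lambda>i. if i \<in> pos f then z else c *\<^sub>C a) = c ^ (m - card (pos f)) *\<^sub>C A (\<lambda>i. if i \<in> pos f then z else a)" for f
      proof -
        have "(\<lambda>i. if i \<in> pos f then z else c *\<^sub>C a) =
            (\<lambda>i. (if i \<in> pos f then 1 else c) *\<^sub>C (if i \<in> pos f then z else a))"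
          by (auto simp: scaleC_one)
        moreover have "(\<Prod>i<m. if i \<in> pos f then 1 else c) = c ^ card ({..<m} - pos f)"
          by (simp add: prod.If_cases Diff_eq)
        ultimately show ?thesis
          using pos[of f] by (simp add: multilinear_map_scaleC_all[OF A] card_Diff_subset)
      qed
      then show ?thesis
        by (simp add: T_def scaleC.scale_sum_right)
    qed
  qed
qed

section \<open>Extraction of components by roots of unity\<close>

text \<open>Order \<open>m + 1\<close> is chosen because the degrees 0 to m are pairwise incongruent
  modulo \<open>m + 1\<close>.\<close>

definition unity_root :: "nat \<Rightarrow> complex"
  where "unity_root m = cis (2 * pi / real (Suc m))"

lemma norm_unity_root: "cmod (unity_root m ^ k) = 1"
  by (simp add: unity_root_def norm_power)

text \<open>Orthogonality of characters: this is a geometric sum with ratio \<open>r\<close>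
  satisfying \<open>r ^ Suc m = 1\<close>, and \<open>r = 1\<close> only for \<open>k = l\<close>,
  because the powers of the root with exponents up to \<open>m\<close> are distinct.\<close>

lemma sum_unity_root:
  assumes "k \<le> m" "l \<le> m"
  shows "(\<Sum>j\<le>m. inverse (unity_root m) ^ (j * l) * unity_root m ^ (j * k)) = (if k = l then of_nat (Suc m) else 0)"
proof -
  let ?w = "unity_root m"
  define r where "r = inverse ?w ^ l * ?w ^ k"
  have w: "?w \<noteq> 0"
    using norm_unity_root[of m 1] by force
  have "?w ^ Suc m = cis (real (Suc m) * (2 * pi / real (Suc m)))"
    unfolding unity_root_def by (rule Complex.DeMoivre)
  then have "?w ^ Suc m = 1"
    by (simp del: of_nat_Suc power_Suc)
  then have r1: "r ^ Suc m = 1"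
    unfolding r_def power_mult_distrib
    by (metis mult_1 power_inverse power_mult mult.commute power_one inverse_1)
  have sum: "(\<Sum>j\<le>m. inverse ?w ^ (j * l) * ?w ^ (j * k)) = (\<Sum>j<Suc m. r ^ j)"
    unfolding r_def power_mult_distrib lessThan_Suc_atMost by (simp flip: power_mult add: mult.commute)
  show ?thesis
  proof (cases "k = l")
    case True
    then have "r = 1"
      using w by (simp add: r_def flip: power_mult_distrib)
    then show ?thesis
      unfolding sum using True by simp
  next
    case False
    have "r \<noteq> 1"
    proof
      assume "r = 1"
      let ?c = "\<lambda>j. cis (2 * pi * real j / real (Suc m))"
      have "?w ^ l * r = ?w ^ k"
        using w by (simp add: r_def power_inverse)
      moreover have pow: "?w ^ j = ?c j" for j
        unfolding unity_root_def Complex.DeMoivre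
        by (simp only: times_divide_eq_right mult.commute[of "real j"])
      ultimately have "?c k = ?c l"
        using \<open>r = 1\<close> by (simp only: mult_1_right)
      moreover have "inj_on ?c {..<Suc m}"
        by (rule bij_betw_imp_inj_on[OF Complex.bij_betw_roots_unity]) simp
      ultimately have "k = l"
        using assms by (elim inj_onD) auto
      then show False
        using False by contradiction
    qed
    then show ?thesis
      unfolding sum using False r1 geometric_sum[of r "Suc m"] by simp
  qed
qed

definition fourier_component ::
    "nat \<Rightarrow> ('a::complex_banach \<Rightarrow> 'b::complex_banach) \<Rightarrow> 'a \<Rightarrow> nat \<Rightarrow> 'a \<Rightarrow> 'b"
  where "fourier_component m P a l z = (\<Sum>j\<le>m. (inverse (unity_root m) ^ (j * l) / of_nat (Suc m)) *\<^sub>C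
    P (a + unity_root m ^ j *\<^sub>C z))"

text \<open>The degree \<open>k\<close> term gains the \<open>j * k\<close>-th power of the root at
  the j-th point, and orthogonality isolates \<open>k = l\<close>. Any decomposition into
  homogeneous terms is allowed, so the lemma serves both existence and uniqueness.\<close>

lemma fourier_component_eq:
  assumes hom: "\<And>k c z. k \<le> m \<Longrightarrow> Q k (c *\<^sub>C z) = c ^ k *\<^sub>C Q k z"
    and P: "\<And>z. P (a + z) = (\<Sum>k\<le>m. Q k z)" and l: "l \<le> m"
  shows "fourier_component m P a l = Q l"
proof
  fix z
  let ?w = "unity_root m"
  have "fourier_component m P a l z =
      (\<Sum>j\<le>m. \<Sum>k\<le>m. (inverse ?w ^ (j * l) * ?w ^ (j * k) / of_nat (Suc m)) *\<^sub>C Q k z)"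
    by (simp add: fourier_component_def P hom scaleC.scale_sum_right scaleC_scaleC flip: power_mult)
  also have "\<dots> = (\<Sum>k\<le>m. \<Sum>j\<le>m. (inverse ?w ^ (j * l) * ?w ^ (j * k) / of_nat (Suc m)) *\<^sub>C Q k z)"
    by (rule sum.swap)
  also have "\<dots> = (\<Sum>k\<le>m. ((\<Sum>j\<le>m. inverse ?w ^ (j * l) * ?w ^ (j * k)) / of_nat (Suc m)) *\<^sub>C Q k z)"
    by (simp only: sum_divide_distrib scaleC.scale_sum_left)
  also have "\<dots> = (\<Sum>k\<le>m. if k = l then Q k z else 0)"
  proof (rule sum.cong)
    fix k
    assume "k \<in> {..m}"
    then show "((\<Sum>j\<le>m. inverse ?w ^ (j * l) * ?w ^ (j * k)) / of_nat (Suc m)) *\<^sub>C Q k z = (if k = l then Q k z else 0)"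
      using sum_unity_root[of k m l] l by (simp add: scaleC_one del: of_nat_Suc)
  qed simp
  also have "\<dots> = Q l z"
    using l by (simp add: sum.delta)
  finally show "fourier_component m P a l z = Q l z" .
qed

lemma taylor_component:
  fixes P :: "'a::complex_banach \<Rightarrow> 'b::complex_banach"
  assumes P: "P \<in> hpoly m" and l: "l \<le> m"
  shows "taylor_component m P a l = fourier_component m P a l"
    and "fourier_component m P a l \<in> hpoly l"
    and "fourier_component m P (c *\<^sub>C a) l z = c ^ (m - l) *\<^sub>C fourier_component m P a l z"
proof -
  obtain T B where B: "\<And>a k. k \<le> m \<Longrightarrow> multilinear_map k (B a k)"
    and TB: "\<And>a k z. k \<le> m \<Longrightarrow> T a k z = B a k (\<lambda>_. z)"
    and sum: "\<And>a z. P (a + z) = (\<Sum>k\<le>m. T a k z)"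
    and hom: "\<And>a k z c. k \<le> m \<Longrightarrow> T (c *\<^sub>C a) k z = c ^ (m - k) *\<^sub>C T a k z"
    by (rule hpoly_taylor_expansion[OF P]) blast
  have T: "fourier_component m P a k = T a k" if "k \<le> m" for a k
  proof (rule fourier_component_eq)
    show "P (a + z) = (\<Sum>k\<le>m. T a k z)" for z
      by (rule sum)
    show "k \<le> m"
      by (rule that)
    show "T a k (c *\<^sub>C z) = c ^ k *\<^sub>C T a k z" if "k \<le> m" for k c z
      using multilinear_map_scaleC_all[OF B[OF that], of a "\<lambda>_. c" "\<lambda>_. z"] that by (simp add: TB)
  qed
  have cont: "continuous_on UNIV P"
    using P by (simp add: hpoly_def)
  have hpoly: "T a k \<in> hpoly k" if "k \<le> m" for a k
  proof (rule hpolyI)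
    show "multilinear_map k (B a k)" "T a k z = B a k (\<lambda>_. z)" for z
      using that by (fact B TB)+
    \<comment> \<open>Continuity is read off the averaging formula, a finite combination of values
      of the continuous \<open>P\<close>.\<close>
    have "continuous_on UNIV (\<lambda>z. fourier_component m P a k z)"
      unfolding fourier_component_def
      by (intro continuous_intros continuous_on_compose2[OF cont]) auto
    then show "continuous_on UNIV (T a k)"
      using T[OF that] by simp
  qed
  show "fourier_component m P a l \<in> hpoly l"
    using T hpoly l by simp
  show "fourier_component m P (c *\<^sub>C a) l z = c ^ (m - l) *\<^sub>C fourier_component m P a l z"
    using T hom l by simp
  show "taylor_component m P a l = fourier_component m P a l"
    unfolding taylor_component_def
  proof (rule the_equality)
    have "P x = (\<Sum>k\<le>m. T a k (x - a))" for x
      using sum[of a "x - a"] by simp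
    then show "\<exists>Q. (\<forall>k\<le>m. Q k \<in> hpoly k) \<and> (\<forall>x. P x = (\<Sum>k\<le>m. Q k (x - a))) \<and> fourier_component m P a l = Q l"
      using hpoly T[OF l] by blast
  next
    \<comment> \<open>The average involves only values of \<open>P\<close>, so it determines the
      terms of every competing decomposition.\<close>
    fix R
    assume "\<exists>Q. (\<forall>k\<le>m. Q k \<in> hpoly k) \<and> (\<forall>x. P x = (\<Sum>k\<le>m. Q k (x - a))) \<and> R = Q l"
    then obtain Q where Q: "\<And>k. k \<le> m \<Longrightarrow> Q k \<in> hpoly k" "\<And>x. P x = (\<Sum>k\<le>m. Q k (x - a))" "R = Q l"
      by blast
    show "R = fourier_component m P a l"
      unfolding Q(3)
      by (rule fourier_component_eq[symmetric]) (use Q l in \<open>auto intro: hpoly_homogeneous\<close>)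
  qed
qed

section \<open>The norm \<open>\<kappa>\<^sub>p\<close>\<close>

text \<open>Transfers an estimate linear in \<open>B\<close> from all \<open>B\<close> above an
  infimum to the infimum itself.\<close>

lemma le_mult_if_le_mult_above:
  fixes b :: real
  assumes "0 \<le> c" and le: "\<And>B. b < B \<Longrightarrow> x \<le> c * B"
  shows "x \<le> c * b"
proof (cases "c = 0")
  case True
  then show ?thesis
    using le[of "b + 1"] by simp
next
  case False
  show ?thesis
  proof (rule dense_ge)
    fix y
    assume "c * b < y"
    then show "x \<le> y"
      using le[of "y / c"] False \<open>0 \<le> c\<close> by (simp add: pos_less_divide_eq mult.commute)
  qed
qed

text \<open>A case of \<open>p_dominated_suminf\<close>: the first term is \<open>f\<close>, and
  \<open>g\<close> is spread over the others with weights 1/2, 1/4, ... Padding with zero bounds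
  would violate the strict positivity required there.\<close>

lemma p_dominated_add:
  fixes f g :: "'i \<Rightarrow> 'a::complex_banach"
  assumes p: "1 \<le> p" and A: "0 < A" "p_dominated p A (f ` I)" and B: "0 < B" "p_dominated p B (g ` I)"
  shows "p_dominated p (A + B) ((\<lambda>x. f x + g x) ` I)"
proof -
  define h where "h j = (case j of 0 \<Rightarrow> f | Suc k \<Rightarrow> (\<lambda>x. complex_of_real ((1 / 2) ^ Suc k) *\<^sub>C g x))" for j
  define C where "C j = (case j of 0 \<Rightarrow> A | Suc k \<Rightarrow> (1 / 2) ^ Suc k * B)" for j :: nat
  have "(\<lambda>k. C (Suc k)) sums B"
    using sums_mult2[OF power_half_series, of B] by (simp add: C_def)
  then have C: "C sums (A + B)"
    using sums_Suc[of C B] by (simp add: C_def add.commute)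
  have h: "(\<lambda>j. h j x) sums (f x + g x)" for x
  proof -
    have "(\<lambda>k. (1 / 2) ^ Suc k *\<^sub>R g x) sums (1 *\<^sub>R g x)"
      by (rule sums_scaleR_left[OF power_half_series])
    then have "(\<lambda>k. h (Suc k) x) sums g x"
      by (simp add: h_def scaleR_scaleC)
    then show ?thesis
      using sums_Suc[of "\<lambda>j. h j x" "g x"] by (simp add: h_def add.commute)
  qed
  have "p_dominated p (C j) (h j ` I)" for j
  proof (cases j)
    case (Suc k)
    show ?thesis
      using p_dominated_scaleC[OF p B(2), of "complex_of_real ((1 / 2) ^ Suc k)"]
      by (simp add: Suc C_def h_def image_image norm_power norm_mult norm_divide)
  qed (use A in \<open>simp add: C_def h_def\<close>)
  then have "p_dominated p (suminf C) ((\<lambda>x. \<Sum>j. h j x) ` I)"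
    using A(1) B(1) C by (intro p_dominated_suminf[OF p]) (auto simp: C_def sums_iff split: nat.split)
  then show ?thesis
    using C h by (simp add: sums_iff)
qed

lemma p_dominated_sum:
  fixes f :: "nat \<Rightarrow> 'i \<Rightarrow> 'a::complex_banach"
  assumes p: "1 \<le> p" and A: "\<And>j. 0 < A j" and f: "\<And>j. p_dominated p (A j) (f j ` I)"
  shows "p_dominated p (\<Sum>j\<le>n. A j) ((\<lambda>x. \<Sum>j\<le>n. f j x) ` I)"
proof (induction n)
  case (Suc n)
  have "0 < (\<Sum>j\<le>n. A j)"
    using A by (intro sum_pos) auto
  from p_dominated_add[OF p this Suc A[of "Suc n"] f[of "Suc n"]] show ?case
    by simp
qed (use f in simp)

lemma
  fixes f g :: "'i \<Rightarrow> 'a::complex_banach"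
  assumes p: "1 \<le> p" and f: "relatively_p_compact p (f ` I)" and g: "relatively_p_compact p (g ` I)"
  shows relatively_p_compact_add: "relatively_p_compact p ((\<lambda>x. f x + g x) ` I)"
    and m_p_add: "m_p p ((\<lambda>x. f x + g x) ` I) \<le> m_p p (f ` I) + m_p p (g ` I)"
proof -
  have dom: "p_dominated p (m_p p (f ` I) + e + (m_p p (g ` I) + e)) ((\<lambda>x. f x + g x) ` I)" if "0 < e" for e
    using that m_p_nonneg[OF p] f g
    by (intro p_dominated_add[OF p] p_dominated_above_m_p[OF p]) (auto intro: add_nonneg_pos)
  show "relatively_p_compact p ((\<lambda>x. f x + g x) ` I)"
    using p_dominated_imp(1)[OF p dom[of 1]] by simp
  show "m_p p ((\<lambda>x. f x + g x) ` I) \<le> m_p p (f ` I) + m_p p (g ` I)"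
  proof (rule field_le_epsilon)
    fix e :: real
    assume "0 < e"
    then show "m_p p ((\<lambda>x. f x + g x) ` I) \<le> m_p p (f ` I) + m_p p (g ` I) + e"
      using p_dominated_imp(2)[OF p dom[of "e / 2"]] by simp
  qed
qed

lemma
  fixes K :: "'a::complex_banach set"
  assumes p: "1 \<le> p" and K: "relatively_p_compact p K"
  shows relatively_p_compact_scaleC: "relatively_p_compact p ((\<lambda>x. c *\<^sub>C x) ` K)"
    and m_p_scaleC_le: "m_p p ((\<lambda>x. c *\<^sub>C x) ` K) \<le> cmod c * m_p p K"
proof -
  have dom: "p_dominated p (cmod c * B) ((\<lambda>x. c *\<^sub>C x) ` K)" if "m_p p K < B" for B
    by (intro p_dominated_scaleC p_dominated_above_m_p p K that)
  show "relatively_p_compact p ((\<lambda>x. c *\<^sub>C x) ` K)"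
    using p_dominated_imp(1)[OF p dom[of "m_p p K + 1"]] by simp
  show "m_p p ((\<lambda>x. c *\<^sub>C x) ` K) \<le> cmod c * m_p p K"
    by (rule le_mult_if_le_mult_above[OF norm_ge_zero p_dominated_imp(2)[OF p dom]])
qed

text \<open>For \<open>c \<noteq> 0\<close> the reverse inequality is the upper bound for the factor
  \<open>1 / c\<close>.\<close>

lemma m_p_scaleC:
  fixes K :: "'a::complex_banach set"
  assumes p: "1 \<le> p" and K: "relatively_p_compact p K"
  shows "m_p p ((\<lambda>x. c *\<^sub>C x) ` K) = cmod c * m_p p K"
proof (rule antisym[OF m_p_scaleC_le[OF p K]])
  show "cmod c * m_p p K \<le> m_p p ((\<lambda>x. c *\<^sub>C x) ` K)"
  proof (cases "c = 0")
    case True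
    then show ?thesis
      using m_p_nonneg[OF p relatively_p_compact_scaleC[OF p K, of c]]
      by (simp only: True norm_zero mult_zero_left)
  next
    case False
    have "(\<lambda>x. (1 / c) *\<^sub>C x) ` (\<lambda>x. c *\<^sub>C x) ` K = K"
      using False by (simp add: image_image scaleC_scaleC scaleC_one)
    then have "m_p p K \<le> cmod (1 / c) * m_p p ((\<lambda>x. c *\<^sub>C x) ` K)"
      using m_p_scaleC_le[OF p relatively_p_compact_scaleC[OF p K], of "1 / c" c] by simp
    then show ?thesis
      using False by (simp add: norm_divide field_simps)
  qed
qed

lemma relatively_p_compact_singleton: "1 \<le> p \<Longrightarrow> relatively_p_compact p {x}"
  using p_dominated_imp(1) p_dominated_singleton by blast

lemma m_p_singleton:
  assumes "1 \<le> p"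
  shows "m_p p {x} = norm x"
  using p_dominated_imp(2)[OF assms p_dominated_singleton[OF assms]]
    norm_le_m_p[OF assms relatively_p_compact_singleton[OF assms]] by (force intro: antisym)

section \<open>Norm axioms and completeness\<close>

lemma complex_subspace_p_compact_hpoly:
  assumes p: "1 \<le> p"
  shows "complex_subspace (p_compact_hpoly p m :: ('a::complex_banach \<Rightarrow> 'b::complex_banach) set)"
proof -
  have "relatively_p_compact p ((\<lambda>_::'a. 0::'b) ` cball 0 1)"
    using relatively_p_compact_singleton[OF p, of 0] by (simp add: image_constant_conv)
  moreover have "relatively_p_compact p ((\<lambda>x. c *\<^sub>C f x) ` cball 0 1)"
    if "relatively_p_compact p (f ` cball 0 1)" for c and f :: "'a \<Rightarrow> 'b"
    using relatively_p_compact_scaleC[OF p that] by (simp add: image_image)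
  ultimately show ?thesis
    using complex_subspace_hpoly[of m, where 'a = 'a and 'b = 'b]
    by (simp add: complex_subspace_def p_compact_hpoly_def relatively_p_compact_add[OF p])
qed

lemma complex_subspace_diff:
  assumes "complex_subspace S" "f \<in> S" "g \<in> S"
  shows "(\<lambda>x. f x - g x) \<in> S"
proof -
  have add: "\<forall>f\<in>S. \<forall>g\<in>S. (\<lambda>x. f x + g x) \<in> S" and scale: "\<forall>c. \<forall>f\<in>S. (\<lambda>x. c *\<^sub>C f x) \<in> S"
    using assms(1) by (simp_all add: complex_subspace_def)
  have "(\<lambda>x. f x + (- 1) *\<^sub>C g x) \<in> S"
    by (rule bspec[OF bspec[OF add assms(2)] bspec[OF spec[OF scale, of "- 1"] assms(3)]])
  then show ?thesis
    by (simp add: scaleC_one)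
qed

lemma scaleC_norm_sgn: "complex_of_real (norm x) *\<^sub>C sgn x = x"
  by (cases "x = 0") (simp_all add: sgn_div_norm flip: scaleR_scaleC)

text \<open>Homogeneity reduces the claim to \<open>sgn x\<close>, which lies in the unit ball even
  for \<open>x = 0\<close>. Consequently convergence in \<open>kappa_p\<close> is uniform on bounded
  sets.\<close>

lemma norm_le_kappa_p:
  assumes p: "1 \<le> p" and f: "f \<in> p_compact_hpoly p m"
  shows "norm (f x) \<le> kappa_p p f * norm x ^ m"
proof -
  have "norm (sgn x) \<le> 1"
    by (simp add: norm_sgn)
  then have le: "norm (f (sgn x)) \<le> kappa_p p f"
    using f norm_le_m_p[OF p, of "f ` cball 0 1"] by (simp add: p_compact_hpoly_def kappa_p_def)
  have "f x = complex_of_real (norm x) ^ m *\<^sub>C f (sgn x)"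
    using hpoly_homogeneous[of f m "complex_of_real (norm x)" "sgn x"] f
    by (simp add: scaleC_norm_sgn p_compact_hpoly_def)
  then have "norm (f x) = norm x ^ m * norm (f (sgn x))"
    by (simp add: norm_scaleC norm_power)
  then show ?thesis
    using mult_left_mono[OF le, of "norm x ^ m"] by (simp add: mult.commute)
qed

lemma norm_on_kappa_p:
  assumes p: "1 \<le> p"
  shows "norm_on (p_compact_hpoly p m :: ('a::complex_banach \<Rightarrow> 'b::complex_banach) set) (kappa_p p)"
  unfolding norm_on_def
proof (intro conjI ballI allI)
  fix f g :: "'a \<Rightarrow> 'b" and c :: complex
  assume f: "f \<in> p_compact_hpoly p m"
  then have rf: "relatively_p_compact p (f ` cball 0 1)"
    by (simp add: p_compact_hpoly_def)
  show "0 \<le> kappa_p p f"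
    unfolding kappa_p_def by (rule m_p_nonneg[OF p rf])
  show "kappa_p p f = 0 \<longleftrightarrow> f = (\<lambda>_. 0)"
  proof
    show "kappa_p p f = 0 \<Longrightarrow> f = (\<lambda>_. 0)"
      using norm_le_kappa_p[OF p f] by (simp add: fun_eq_iff)
    show "f = (\<lambda>_. 0) \<Longrightarrow> kappa_p p f = 0"
      using m_p_singleton[OF p, of "0::'b"] by (simp add: kappa_p_def image_constant_conv)
  qed
  show "kappa_p p (\<lambda>x. c *\<^sub>C f x) = cmod c * kappa_p p f"
    using m_p_scaleC[OF p rf] by (simp add: kappa_p_def image_image)
  show "kappa_p p (\<lambda>x. f x + g x) \<le> kappa_p p f + kappa_p p g" if "g \<in> p_compact_hpoly p m"
    using m_p_add[OF p rf, of g] that by (simp add: kappa_p_def p_compact_hpoly_def)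
qed

text \<open>The limit exists uniformly on bounded sets, so it is continuous and, by
  \<open>hpoly_limit\<close>, a homogeneous polynomial. The error \<open>X n - L\<close> is then a
  telescoping series whose terms have gauges below e/2, e/4, ..., hence is dominated by
  \<open>e\<close>.\<close>

lemma complete_for_kappa_p:
  assumes p: "1 \<le> p"
  shows "complete_for (p_compact_hpoly p m :: ('a::complex_banach \<Rightarrow> 'b::complex_banach) set) (kappa_p p)"
  unfolding complete_for_def
proof (intro allI impI)
  fix X :: "nat \<Rightarrow> 'a \<Rightarrow> 'b"
  assume "\<forall>n. X n \<in> p_compact_hpoly p m"
  then have X: "X n \<in> p_compact_hpoly p m" for n
    by simp
  assume "\<forall>e>0. \<exists>M. \<forall>i\<ge>M. \<forall>j\<ge>M. kappa_p p (\<lambda>x. X i x - X j x) < e"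
  then have "\<forall>e. \<exists>M. 0 < e \<longrightarrow> (\<forall>i\<ge>M. \<forall>j\<ge>M. kappa_p p (\<lambda>x. X i x - X j x) < e)"
    by blast
  then obtain M where M: "\<And>e i j. 0 < e \<Longrightarrow> M e \<le> i \<Longrightarrow> M e \<le> j \<Longrightarrow> kappa_p p (\<lambda>x. X i x - X j x) < e"
    by metis
  note diff = complex_subspace_diff[OF complex_subspace_p_compact_hpoly[OF p]]
  have bound: "norm (X i x - X j x) \<le> e * norm x ^ m" if "0 < e" "M e \<le> i" "M e \<le> j" for e i j x
    using norm_le_kappa_p[OF p diff[OF X[of i] X[of j]], of x] M[OF that]
      mult_right_mono[of _ e "norm x ^ m"] by (meson less_imp_le norm_ge_zero order_trans zero_le_power)
  have "Cauchy (\<lambda>n. X n x)" for x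
  proof (rule CauchyI)
    fix e :: real
    assume "0 < e"
    define d where "d = e / (norm x ^ m + 1)"
    have "0 < norm x ^ m + 1"
      by (simp add: add_nonneg_pos)
    then have "0 < d" "d * norm x ^ m < e"
      using \<open>0 < e\<close> by (simp_all add: d_def field_simps)
    then show "\<exists>M. \<forall>i\<ge>M. \<forall>j\<ge>M. norm (X i x - X j x) < e"
      using bound[of d _ _ x] by (meson le_less_trans)
  qed
  then have "\<exists>l. (\<lambda>n. X n x) \<longlonglongrightarrow> l" for x
    by (simp add: Cauchy_convergent_iff convergent_def)
  then obtain L where L: "\<And>x. (\<lambda>n. X n x) \<longlonglongrightarrow> L x"
    by metis
  have limit_bound: "norm (X i x - L x) \<le> e * norm x ^ m" if "0 < e" "M e \<le> i" for e i x
  proof (rule LIMSEQ_le_const2)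
    show "(\<lambda>j. norm (X i x - X j x)) \<longlonglongrightarrow> norm (X i x - L x)"
      by (intro tendsto_intros L)
    show "\<exists>N. \<forall>j\<ge>N. norm (X i x - X j x) \<le> e * norm x ^ m"
      using bound[OF that] by blast
  qed
  have cont_ball: "continuous_on (ball 0 r) L" for r
  proof (rule uniform_limit_theorem)
    show "\<forall>\<^sub>F n in sequentially. continuous_on (ball 0 r) (X n)"
    proof (rule always_eventually, rule allI)
      fix n
      have "continuous_on UNIV (X n)"
        using X[of n] by (simp add: p_compact_hpoly_def hpoly_def)
      then show "continuous_on (ball 0 r) (X n)"
        by (rule continuous_on_subset) simp
    qed
    show "uniform_limit (ball 0 r) X L sequentially"
    proof (rule uniform_limitI)
      fix e :: real
      assume "0 < e"
      define d where "d = e / (\<bar>r\<bar> ^ m + 1)"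
      have "0 < \<bar>r\<bar> ^ m + 1"
        by (simp add: add_nonneg_pos)
      then have d: "0 < d" "d * \<bar>r\<bar> ^ m < e"
        using \<open>0 < e\<close> by (simp_all add: d_def field_simps)
      have "dist (X n x) (L x) < e" if "M d \<le> n" "x \<in> ball 0 r" for n x
      proof -
        have "norm x ^ m \<le> \<bar>r\<bar> ^ m"
          using that(2) by (intro power_mono) auto
        then have "norm (X n x - L x) \<le> d * \<bar>r\<bar> ^ m"
          using d(1) by (intro order_trans[OF limit_bound[OF d(1) that(1)]] mult_left_mono) auto
        then show ?thesis
          using d(2) by (simp add: dist_norm)
      qed
      then show "\<forall>\<^sub>F n in sequentially. \<forall>x\<in>ball 0 r. dist (X n x) (L x) < e"
        unfolding eventually_sequentially by blast
    qed
  qed simp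
  have "isCont L x" for x
  proof -
    have "x \<in> ball 0 (norm x + 1)"
      by simp
    then show ?thesis
      using cont_ball continuous_on_eq_continuous_at open_ball by blast
  qed
  then have "continuous_on UNIV L"
    by (simp add: continuous_at_imp_continuous_on)
  moreover have X_hpoly: "X n \<in> hpoly m" for n
    using X[of n] by (simp add: p_compact_hpoly_def)
  ultimately have L_hpoly: "L \<in> hpoly m"
    using hpoly_limit[OF X_hpoly L] by blast
  have dom: "p_dominated p e ((\<lambda>x. X n x - L x) ` cball 0 1)" if e: "0 < e" and n: "M (e * (1 / 2) ^ Suc 0) \<le> n" for e n
  proof -
    define d where "d j = e * (1 / 2) ^ Suc j" for j
    \<comment> \<open>The sum keeps \<open>N j\<close> above \<open>M (d j)\<close> and makes it
      monotone; the summand \<open>j\<close> forces divergence. Index 0 is left out since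
      \<open>n\<close> exceeds \<open>M (d 0)\<close> by assumption and the telescope must start at
      \<open>N 0 = n\<close>.\<close>
    define N where "N j = n + (\<Sum>i\<in>{1..j}. M (d i)) + j" for j
    have d: "0 < d j" for j
      using e by (simp add: d_def)
    have N: "M (d j) \<le> N j" for j
    proof (cases j)
      case (Suc k)
      then have "M (d j) \<le> (\<Sum>i\<in>{1..j}. M (d i))"
        by (intro member_le_sum) auto
      then show ?thesis
        by (simp add: N_def)
    qed (use n in \<open>simp add: N_def d_def\<close>)
    have N_Suc: "M (d j) \<le> N (Suc j)" for j
      using N[of j] by (simp add: N_def)
    have "filterlim N at_top sequentially"
      by (rule filterlim_at_top_mono[OF filterlim_ident]) (simp add: N_def)
    then have lim: "(\<lambda>j. X (N j) x) \<longlonglongrightarrow> L x" for x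
      by (rule filterlim_compose[OF L])
    have "p_dominated p (d j) ((\<lambda>x. X (N j) x - X (N (Suc j)) x) ` cball 0 1)" for j
      using M[OF d N N_Suc, of j] diff[OF X[of "N j"] X[of "N (Suc j)"]]
      by (intro p_dominated_above_m_p[OF p]) (auto simp: p_compact_hpoly_def kappa_p_def)
    moreover have "d sums e"
      using sums_mult[OF power_half_series, of e] by (simp add: d_def[abs_def])
    ultimately have "p_dominated p (suminf d) ((\<lambda>x. \<Sum>j. X (N j) x - X (N (Suc j)) x) ` cball 0 1)"
      using d by (intro p_dominated_suminf[OF p]) (auto simp: sums_iff)
    moreover have "(\<Sum>j. X (N j) x - X (N (Suc j)) x) = X n x - L x" for x
      using telescope_sums'[OF lim, of x] by (simp add: sums_iff N_def)
    ultimately show ?thesis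
      using \<open>d sums e\<close> by (simp add: sums_iff)
  qed
  have XL: "(\<lambda>x. X n x - L x) \<in> hpoly m" for n
    by (rule complex_subspace_diff[OF complex_subspace_hpoly X_hpoly L_hpoly])
  show "\<exists>L\<in>p_compact_hpoly p m. (\<lambda>n. kappa_p p (\<lambda>x. X n x - L x)) \<longlonglongrightarrow> 0"
  proof
    \<comment> \<open>A single index suffices for membership, as \<open>L\<close> is
      \<open>X n\<close> minus the p-compact difference \<open>X n - L\<close>.\<close>
    define n where "n = M (1 * (1 / 2) ^ Suc 0)"
    have "(\<lambda>x. X n x - L x) \<in> p_compact_hpoly p m"
      using XL p_dominated_imp(1)[OF p dom[of 1 n]] by (simp add: p_compact_hpoly_def n_def)
    from diff[OF X[of n] this] show "L \<in> p_compact_hpoly p m"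
      by simp
    then have mem: "(\<lambda>x. X n x - L x) \<in> p_compact_hpoly p m" for n
      by (rule diff[OF X])
    show "(\<lambda>n. kappa_p p (\<lambda>x. X n x - L x)) \<longlonglongrightarrow> 0"
    proof (rule LIMSEQ_I)
      fix e :: real
      assume "0 < e"
      \<comment> \<open>Domination gives only a weak inequality; halving \<open>e\<close> makes it
        strict.\<close>
      then have "0 < e / 2"
        by simp
      have "norm (kappa_p p (\<lambda>x. X n x - L x) - 0) < e" if "M (e / 2 * (1 / 2) ^ Suc 0) \<le> n" for n
      proof -
        have "kappa_p p (\<lambda>x. X n x - L x) \<le> e / 2"
          unfolding kappa_p_def by (rule p_dominated_imp(2)[OF p dom[OF \<open>0 < e / 2\<close> that]])
        moreover have "0 \<le> kappa_p p (\<lambda>x. X n x - L x)"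
          unfolding kappa_p_def using mem[of n] by (intro m_p_nonneg[OF p]) (simp add: p_compact_hpoly_def)
        ultimately show ?thesis
          using \<open>0 < e\<close> by simp
      qed
      then show "\<exists>no. \<forall>n\<ge>no. norm (kappa_p p (\<lambda>x. X n x - L x) - 0) < e"
        by blast
    qed
  qed
qed

text \<open>For \<open>\<parallel>u\<parallel> \<le> 1\<close> the Taylor component is an average of values of \<open>P\<close> on the ball of radius 2, hence the
  factor \<open>2\<^sup>m\<close>.\<close>

lemma p_dominated_fourier_component:
  fixes P :: "'a::complex_banach \<Rightarrow> 'b::complex_banach"
  assumes p: "1 \<le> p" and P: "P \<in> hpoly m" and B: "0 < B" "p_dominated p B (P ` cball 0 1)" and u: "norm u \<le> 1"
  shows "p_dominated p (2 ^ m * B) (fourier_component m P u l ` cball 0 1)"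
proof -
  define c where "c j = inverse (unity_root m) ^ (j * l) / of_nat (Suc m)" for j
  define f where "f j z = c j *\<^sub>C P (u + unity_root m ^ j *\<^sub>C z)" for j z
  have c: "cmod (c j) = 1 / real (Suc m)" for j
    using norm_unity_root[of m "j * l"]
    by (simp add: c_def norm_divide norm_inverse power_inverse del: of_nat_Suc)
  have "p_dominated p (2 ^ m * B / real (Suc m)) (f j ` cball 0 1)" for j
  proof -
    have "f j ` cball 0 1 \<subseteq> (\<lambda>x. (c j * 2 ^ m) *\<^sub>C x) ` P ` cball 0 1"
    proof
      fix w
      assume "w \<in> f j ` cball 0 1"
      then obtain z where z: "norm z \<le> 1" "w = f j z"
        by auto
      \<comment> \<open>Halving brings the point into the unit ball; homogeneity of \<open>P\<close>
        returns the factor \<open>2 ^ m\<close>.\<close>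
      define v where "v = (1 / 2) *\<^sub>C (u + unity_root m ^ j *\<^sub>C z)"
      have "norm (u + unity_root m ^ j *\<^sub>C z) \<le> 2"
        using norm_triangle_ineq[of u "unity_root m ^ j *\<^sub>C z"] u z(1)
        by (simp add: norm_scaleC norm_unity_root)
      then have "v \<in> cball 0 1"
        by (simp add: v_def norm_scaleC norm_divide)
      moreover have "u + unity_root m ^ j *\<^sub>C z = 2 *\<^sub>C v"
        by (simp add: v_def scaleC_scaleC scaleC_one)
      then have "w = (c j * 2 ^ m) *\<^sub>C P v"
        by (simp add: z(2) f_def hpoly_homogeneous[OF P] scaleC_scaleC)
      ultimately show "w \<in> (\<lambda>x. (c j * 2 ^ m) *\<^sub>C x) ` P ` cball 0 1"
        by blast
    qed
    moreover have "cmod (c j * 2 ^ m) * B = 2 ^ m * B / real (Suc m)"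
      by (simp add: norm_mult norm_power c)
    ultimately show ?thesis
      using p_dominated_subset p_dominated_scaleC[OF p B(2), of "c j * 2 ^ m"] by metis
  qed
  \<comment> \<open>There are \<open>m + 1\<close> terms, each with the weight
    \<open>1 / real (Suc m)\<close>.\<close>
  then have "p_dominated p (\<Sum>j\<le>m. 2 ^ m * B / real (Suc m)) ((\<lambda>z. \<Sum>j\<le>m. f j z) ` cball 0 1)"
    using B(1) by (intro p_dominated_sum[OF p]) auto
  moreover have "fourier_component m P u l = (\<lambda>z. \<Sum>j\<le>m. f j z)"
    by (simp add: fun_eq_iff fourier_component_def f_def c_def)
  moreover have "(\<Sum>j\<le>m. 2 ^ m * B / real (Suc m)) = 2 ^ m * B"
    by (simp del: of_nat_Suc)
  ultimately show ?thesis
    by simp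
qed

section \<open>The Taylor estimate and the holomorphy type\<close>

text \<open>Writing \<open>a\<close> as its norm times \<open>u = sgn a\<close> and using
  homogeneity of degree \<open>m - l\<close> in the centre reduces everything to
  \<open>norm u \<le> 1\<close>. Bounds \<open>B\<close> above \<open>kappa_p p P\<close> provide
  the dominating sequences.\<close>

lemma taylor_component_p_compact_hpoly:
  fixes P :: "'a::complex_banach \<Rightarrow> 'b::complex_banach"
  assumes p: "1 \<le> p" and P: "P \<in> p_compact_hpoly p m" and l: "l \<le> m"
  shows "taylor_component m P a l \<in> p_compact_hpoly p l"
    and "kappa_p p (taylor_component m P a l) \<le> 2 ^ m * kappa_p p P * norm a ^ (m - l)"
proof -
  have P': "P \<in> hpoly m" "relatively_p_compact p (P ` cball 0 1)"
    using P by (simp_all add: p_compact_hpoly_def)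
  let ?T = "taylor_component m P a l"
  define u where "u = sgn a"
  have u: "norm u \<le> 1" and a: "a = complex_of_real (norm a) *\<^sub>C u"
    by (simp_all add: u_def norm_sgn scaleC_norm_sgn)
  have T: "?T = (\<lambda>z. complex_of_real (norm a) ^ (m - l) *\<^sub>C fourier_component m P u l z)"
  proof
    fix z
    have "?T z = fourier_component m P (complex_of_real (norm a) *\<^sub>C u) l z"
      using a taylor_component(1)[OF P'(1) l] by simp
    then show "?T z = complex_of_real (norm a) ^ (m - l) *\<^sub>C fourier_component m P u l z"
      by (simp add: taylor_component(3)[OF P'(1) l])
  qed
  have dom: "p_dominated p (norm a ^ (m - l) * 2 ^ m * B) (?T ` cball 0 1)" if "kappa_p p P < B" for B
  proof -
    have "0 < B" "p_dominated p B (P ` cball 0 1)"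
      using that m_p_nonneg[OF p P'(2)] p_dominated_above_m_p[OF p P'(2)] by (simp_all add: kappa_p_def)
    from p_dominated_scaleC[OF p p_dominated_fourier_component[OF p P'(1) this u], of "complex_of_real (norm a) ^ (m - l)" l]
    show ?thesis
      by (simp add: T image_image norm_power mult.assoc)
  qed
  show "?T \<in> p_compact_hpoly p l"
    using p_dominated_imp(1)[OF p dom[of "kappa_p p P + 1"]] taylor_component[OF P'(1) l]
    by (simp add: p_compact_hpoly_def)
  have "kappa_p p ?T \<le> (norm a ^ (m - l) * 2 ^ m) * kappa_p p P"
  proof (rule le_mult_if_le_mult_above)
    show "kappa_p p ?T \<le> norm a ^ (m - l) * 2 ^ m * B" if "kappa_p p P < B" for B
      unfolding kappa_p_def[of p ?T] by (rule p_dominated_imp(2)[OF p dom[OF that]])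
  qed simp
  then show "kappa_p p ?T \<le> 2 ^ m * kappa_p p P * norm a ^ (m - l)"
    by (simp add: ac_simps)
qed

theorem theorem5p1:
  fixes p :: real
  assumes "1 \<le> p"
  shows "holomorphy_type
    (\<lambda>m. p_compact_hpoly p m :: ('e::complex_banach \<Rightarrow> 'f::complex_banach) set)
    (\<lambda>m. kappa_p p)"
  unfolding holomorphy_type_def
proof (intro conjI allI)
  fix m
  show "(p_compact_hpoly p m :: ('e \<Rightarrow> 'f) set) \<subseteq> hpoly m"
    by (auto simp: p_compact_hpoly_def)
  show "banach_function_space (p_compact_hpoly p m :: ('e \<Rightarrow> 'f) set) (kappa_p p)"
    unfolding banach_function_space_def
    using assms by (intro conjI complex_subspace_p_compact_hpoly norm_on_kappa_p complete_for_kappa_p)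
next
  show "kappa_p p (\<lambda>_::'e. c::'f) = norm c" for c
    using m_p_singleton[OF assms, of c] by (simp add: kappa_p_def image_constant_conv)
  have "relatively_p_compact p ((\<lambda>_::'e. c::'f) ` cball 0 1)" for c
    using relatively_p_compact_singleton[OF assms, of c] by (simp add: image_constant_conv)
  then show "(p_compact_hpoly p 0 :: ('e \<Rightarrow> 'f) set) = range (\<lambda>c _. c)"
    by (auto simp: p_compact_hpoly_def hpoly_0)
next
  show "\<exists>\<sigma>\<ge>1. \<forall>m. \<forall>l\<le>m. \<forall>P\<in>p_compact_hpoly p m. \<forall>a::'e.
      taylor_component m P a l \<in> (p_compact_hpoly p l :: ('e \<Rightarrow> 'f) set) \<and>
      kappa_p p (taylor_component m P a l) \<le> \<sigma> ^ m * kappa_p p P * norm a ^ (m - l)"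
    using taylor_component_p_compact_hpoly[OF assms] by (intro exI[of _ 2]) auto
qed

end
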